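(* Assume that $\mathbb{P}$ is $\psi$-mixing and let $t>0$. Then for any nonperiodic sequence $\omega\in\Omega_{\mathbb{P}}$ the sum $S^{A^\omega_n}_N$, with $N=N_n^\omega=[t(\mathbb{P}(A^\omega_n))^{-\ell}]$, considered as a random variable on $(\Omega,\mathcal{F},\mathbb{P})$, converges in distribution as $n\to\infty$ to a Poisson random variable with parameter $t$.
   Context: $\mathbb{N}=\{0,1,2,\dots\}$; $[x]$ is the integral part of a number $x$. $\mathcal{A}$ is a finite or countable alphabet with more than one element, $\Omega=\mathcal{A}^{\mathbb{N}}$, $\mathcal{F}$ is the $\sigma$-algebra generated by cylinder sets, $T$ is the left shift $(T\omega)_i=\omega_{i+1}$, and $\mathbb{P}$ is a $T$-invariant probability on $(\Omega,\mathcal{F})$ such that every cylinder $[a]=\{\omega:\omega_0=a\}$, $a\in\mathcal{A}$, has positive probability. For $0\le k\le n\le\infty$, $\mathcal{F}_{k,n}$ is the $\sigma$-algebra generated by the coordinates $\omega_i$ with $k\le i\le n$ (all $i\geq k$ if $n=\infty$). For $\sigma$-algebras $\mathcal{G},\mathcal{H}\subset\mathcal{F}$, $$\psi(\mathcal{G},\mathcal{H})=\sup\Big\{\Big|\frac{\mathbb{P}(B\cap C)}{\mathbb{P}(B)\mathbb{P}(C)}-1\Big|:B\in\mathcal{G},\,C\in\mathcal{H},\ \mathbb{P}(B)\mathbb{P}(C)\neq0\Big\},\qquad \psi_m=\sup_{n\in\mathbb{N}}\psi(\mathcal{F}_{0,n},\mathcal{F}_{n+m+1,\infty}).$$ $\mathbb{P}$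 is called $\psi$-mixing if $\psi_0<\infty$ and $\psi_m\to0$ as $m\to\infty$. For $\omega\in\Omega$ and $n\ge1$, $A^\omega_n=[\omega_0,\dots,\omega_{n-1}]$ is the cylinder of all sequences whose first $n$ entries coincide with those of $\omega$, and $\Omega_{\mathbb{P}}=\{\omega\in\Omega:\mathbb{P}(A^\omega_n)>0\ \forall n\ge1\}$. A sequence $\omega$ is periodic if $T^d\omega=\omega$ for some $d\ge1$. Let $\ell\ge1$ and $q_i(k)=d_ik$, $i=1,\dots,\ell$, with integers $1\le d_1<d_2<\cdots<d_\ell$. For a cylinder $A$: $X^A_k=\prod_{i=1}^\ell\mathbb{I}_A\circ T^{d_ik}$ and $S^A_N=\sum_{k=1}^NX^A_k$. *)

theory Defs
  imports "HOL-Probability.Probability"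
begin

text \<open>
  The alphabet is a type of class \<open>countable\<close> (finite or countably infinite), and the
  sequence space is the type \<open>nat \<Rightarrow> 'a\<close>.
\<close>

definition cylinder :: "'a list \<Rightarrow> (nat \<Rightarrow> 'a) set" where
  "cylinder w = {\<omega>. \<forall>i<length w. \<omega> i = w ! i}"

definition cylinder_space :: "(nat \<Rightarrow> 'a) measure" where
  "cylinder_space = sigma UNIV (range cylinder)"

definition left_shift :: "(nat \<Rightarrow> 'a) \<Rightarrow> (nat \<Rightarrow> 'a)" where
  "left_shift \<omega> = (\<lambda>i. \<omega> (Suc i))"

text \<open>
  The \<open>\<sigma>\<close>-algebra generated by the coordinates \<open>\<omega> i\<close> with \<open>k \<le> i \<le> n\<close>, where
  \<open>n\<close> may be infinite; the alphabet carries the discrete \<open>\<sigma>\<close>-algebra.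
\<close>

definition coord_algebra :: "nat \<Rightarrow> enat \<Rightarrow> (nat \<Rightarrow> 'a) set set" where
  "coord_algebra k n =
     sigma_sets UNIV {(\<lambda>\<omega>. \<omega> i) -` S | i S. k \<le> i \<and> enat i \<le> n}"

text \<open>The mixing coefficients take values in \<open>ennreal\<close> since the suprema may be infinite.\<close>

definition psi_dep :: "'b measure \<Rightarrow> 'b set set \<Rightarrow> 'b set set \<Rightarrow> ennreal" where
  "psi_dep P \<G> \<H> =
     Sup {ennreal \<bar>measure P (B \<inter> C) / (measure P B * measure P C) - 1\<bar> | B C.
            B \<in> \<G> \<and> C \<in> \<H> \<and> measure P B * measure P C \<noteq> 0}"

definition psi_coeff :: "(nat \<Rightarrow> 'a) measure \<Rightarrow> nat \<Rightarrow> ennreal" where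
  "psi_coeff P m =
     (SUP n. psi_dep P (coord_algebra 0 (enat n)) (coord_algebra (n + m + 1) \<infinity>))"

definition psi_mixing :: "(nat \<Rightarrow> 'a) measure \<Rightarrow> bool" where
  "psi_mixing P \<longleftrightarrow> psi_coeff P 0 < \<infinity> \<and> psi_coeff P \<longlonglongrightarrow> 0"

definition cyl_of :: "(nat \<Rightarrow> 'a) \<Rightarrow> nat \<Rightarrow> (nat \<Rightarrow> 'a) set" where
  "cyl_of \<omega> n = cylinder (map \<omega> [0..<n])"

definition Omega_pos :: "(nat \<Rightarrow> 'a) measure \<Rightarrow> (nat \<Rightarrow> 'a) set" where
  "Omega_pos P = {\<omega>. \<forall>n\<ge>1. measure P (cyl_of \<omega> n) > 0}"

definition periodic_seq :: "(nat \<Rightarrow> 'a) \<Rightarrow> bool" where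
  "periodic_seq \<omega> \<longleftrightarrow> (\<exists>d\<ge>1. (left_shift ^^ d) \<omega> = \<omega>)"

definition X_hit ::
  "nat \<Rightarrow> (nat \<Rightarrow> nat) \<Rightarrow> (nat \<Rightarrow> 'a) set \<Rightarrow> nat \<Rightarrow> (nat \<Rightarrow> 'a) \<Rightarrow> real" where
  "X_hit l d A k = (\<lambda>\<omega>. \<Prod>i=1..l. indicator A ((left_shift ^^ (d i * k)) \<omega>))"

definition S_hit ::
  "nat \<Rightarrow> (nat \<Rightarrow> nat) \<Rightarrow> (nat \<Rightarrow> 'a) set \<Rightarrow> nat \<Rightarrow> (nat \<Rightarrow> 'a) \<Rightarrow> real" where
  "S_hit l d A N = (\<lambda>\<omega>. \<Sum>k=1..N. X_hit l d A k \<omega>)"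

definition N_hit ::
  "(nat \<Rightarrow> 'a) measure \<Rightarrow> nat \<Rightarrow> real \<Rightarrow> (nat \<Rightarrow> 'a) \<Rightarrow> nat \<Rightarrow> nat" where
  "N_hit P l t \<omega> n = nat \<lfloor>t / measure P (cyl_of \<omega> n) ^ l\<rfloor>"

end

theory Submission
  imports Defs
begin

text \<open>
  Let \<open>E k\<close> be the event that \<open>X_hit\<close> equals 1 at \<open>k\<close>, and call \<open>j\<close> a neighbour of \<open>k\<close> if some
  window of \<open>E j\<close> comes within distance \<open>m\<close> of a window of \<open>E k\<close>. If \<open>S\<close> counts all
  hits and \<open>W\<close> only those outside the neighbourhood of \<open>k\<close>, then up to small errors
  \<open>E[1_(E k) e^(iuS)] = E[1_(E k) e^(iu(W+1))] = P(E k) e^(iu) E[e^(iuW)] = P(E k) e^(iu) E[e^(iuS)]\<close>.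
  Summing over \<open>k\<close>, the characteristic function \<open>\<phi>\<close> of \<open>S\<close> almost satisfies the Poisson equation
  \<open>\<phi>' = i \<lambda> e^(iu) \<phi>\<close>, and Levy's continuity theorem applies. The middle step is \<open>\<psi>\<close>-mixing applied
  to windows interlaced with their complement. The other two cost the pair probabilities
  \<open>P(E k \<inter> E j)\<close> of neighbours: the last window of the later index contributes a factor which
  is exponentially small in its distance to the earlier one, and which vanishes for small
  distances because \<open>\<omega>\<close> is not periodic.
\<close>

section \<open>Poisson approximation by characteristic functions\<close>

text \<open>The windows of \<open>E k\<close> start at multiples of \<open>k\<close>, so they are
  scattered along the time axis and interlace with those of other indices: no single cut into past
  and future separates \<open>E k\<close> from the remaining count, although \<open>\<psi>\<close>
  compares only a past with a future. The way out is to decompose the events of the remaining count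
  into atoms that fix every coordinate they see. An atom, unlike a general event, is the
  intersection of its pieces between the windows, and the pieces can be treated one cut at a time.
  The estimates are kept as ratios, since a ratio survives summation over countably many atoms while
  a fixed additive error would not. A second obstacle is that for \<open>k < n + m\<close> the
  windows of one event may overlap or leave too small gaps; there each probability is bounded by
  \<open>p n\<close>, and \<open>(n + m) * p n\<close> tends to 0. Finally, the bound on the number
  of neighbours grows with \<open>n\<close>, so a uniform bound on pair probabilities must beat that
  growth: they are split into a part \<open>p n\<close>, small against that number, and a geometric
  tail independent of it.\<close>

definition hits :: "(nat \<Rightarrow> 'b set) \<Rightarrow> nat set \<Rightarrow> 'b \<Rightarrow> nat" where
  "hits E I x = card {j\<in>I. x \<in> E j}"

lemma hits_le: "finite I \<Longrightarrow> hits E I x \<le> card I"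
  unfolding hits_def by (intro card_mono) auto

lemma hits_eq_sum: "finite I \<Longrightarrow> hits E I x = (\<Sum>j\<in>I. indicator (E j) x)"
  unfolding hits_def by (simp add: indicator_def sum.If_cases Int_def)

lemma hits_mono_diff:
  assumes "finite I" "k \<in> I" "k \<in> B" "x \<in> E k" "\<And>j. j \<in> I \<Longrightarrow> j \<in> B \<Longrightarrow> j \<noteq> k \<Longrightarrow> x \<notin> E j"
  shows "hits E I x = hits E (I - B) x + 1"
proof -
  have "{j\<in>I. x \<in> E j} = insert k {j\<in>I - B. x \<in> E j}"
    using assms by auto
  then show ?thesis
    unfolding hits_def using assms by simp
qed

lemma hits_diff_eq:
  assumes "\<And>j. j \<in> I \<Longrightarrow> j \<in> B \<Longrightarrow> x \<notin> E j"
  shows "hits E (I - B) x = hits E I x"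
proof -
  have "{j\<in>I. x \<in> E j} = {j\<in>I - B. x \<in> E j}"
    using assms by auto
  then show ?thesis
    unfolding hits_def by simp
qed

lemma cmod_iexp_diff_le: "cmod (iexp a - iexp b) \<le> 2"
  using norm_triangle_ineq4[of "iexp a" "iexp b"] by simp

lemma integral_norm_le_integral:
  fixes f :: "'b \<Rightarrow> 'c::{banach, second_countable_topology}"
  assumes "integrable M f" "integrable M g" "\<And>x. x \<in> space M \<Longrightarrow> norm (f x) \<le> g x"
  shows "norm (integral\<^sup>L M f) \<le> integral\<^sup>L M g"
  using assms by (intro order_trans[OF integral_norm_bound integral_mono]) auto

context prob_space
begin

lemma hits_level_sets:
  assumes "finite I" "\<And>j. j \<in> I \<Longrightarrow> E j \<in> events"
  shows "{x\<in>space M. hits E I x = w} \<in> events"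
proof -
  have "(\<lambda>x. \<Sum>j\<in>I. indicator (E j) x :: real) \<in> borel_measurable M"
    using assms by (intro borel_measurable_sum borel_measurable_indicator) auto
  then have "{x\<in>space M. (\<Sum>j\<in>I. indicator (E j) x) = real w} \<in> events"
    by measurable
  then show ?thesis
    by (simp add: hits_eq_sum[OF assms(1)] real_of_nat_indicator flip: of_nat_eq_iff[where 'a = real])
qed

text \<open>Splitting over the values of the count turns such an integral into a finite sum of
  probabilities, the form in which mixing estimates can enter. Here \<open>A\<close> will be one
  event \<open>E k\<close> or the whole space.\<close>

lemma has_integral_hits:
  fixes g :: "nat \<Rightarrow> complex"
  assumes "finite I" "\<And>j. j \<in> I \<Longrightarrow> E j \<in> events" "A \<in> events"
  shows "has_bochner_integral M (\<lambda>x. indicator A x *\<^sub>R g (hits E I x))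
    (\<Sum>w\<le>card I. prob (A \<inter> {x\<in>space M. hits E I x = w}) *\<^sub>R g w)"
proof -
  have *: "has_bochner_integral M
      (\<lambda>x. \<Sum>w\<le>card I. indicator (A \<inter> {x\<in>space M. hits E I x = w}) x *\<^sub>R g w)
      (\<Sum>w\<le>card I. prob (A \<inter> {x\<in>space M. hits E I x = w}) *\<^sub>R g w)"
    using hits_level_sets[OF assms(1,2)] assms(3)
    by (intro has_bochner_integral_sum has_bochner_integral_indicator)
       (auto simp: emeasure_eq_measure)
  show ?thesis
  proof (rule has_bochner_integral_cong[THEN iffD1, OF refl _ refl *])
    fix x assume x: "x \<in> space M"
    have "(\<Sum>w\<le>card I. indicator (A \<inter> {x\<in>space M. hits E I x = w}) x *\<^sub>R g w)
        = (\<Sum>w\<le>card I. if hits E I x = w then indicator A x *\<^sub>R g w else 0)"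
      using x by (intro sum.cong) (auto simp: indicator_def)
    also have "\<dots> = indicator A x *\<^sub>R g (hits E I x)"
      using hits_le[OF assms(1), of E x] by (subst sum.delta') auto
    finally show "(\<Sum>w\<le>card I. indicator (A \<inter> {x\<in>space M. hits E I x = w}) x *\<^sub>R g w)
        = indicator A x *\<^sub>R g (hits E I x)" .
  qed
qed

text \<open>The integrands differ only on a small set, and there by at most 2. On
  \<open>E k\<close>, removing \<open>B\<close> from the count lowers it by exactly 1 unless a
  second event of \<open>B\<close> occurs; without \<open>E k\<close>, removing \<open>B\<close>
  changes nothing unless some event of \<open>B\<close> occurs. In between, \<open>\<eta>\<close>
  bounds the l1 distance between the law of the reduced count on \<open>E k\<close> and its product
  version.\<close>

lemma hit_term_approx:
  fixes u :: real
  assumes fin: "finite I" and ev: "\<And>j. j \<in> I \<Longrightarrow> E j \<in> events"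
    and k: "k \<in> I" "k \<in> B" and B: "B \<subseteq> I"
    and \<eta>: "(\<Sum>w\<le>card (I - B). \<bar>prob (E k \<inter> {x\<in>space M. hits E (I - B) x = w})
             - prob (E k) * prob {x\<in>space M. hits E (I - B) x = w}\<bar>) \<le> \<eta>"
  shows "cmod ((CLINT x|M. indicator (E k) x *\<^sub>R iexp (u * hits E I x))
           - prob (E k) *\<^sub>R (iexp u * (CLINT x|M. iexp (u * hits E I x))))
       \<le> 2 * (\<Sum>j\<in>B - {k}. prob (E k \<inter> E j)) + 2 * (\<Sum>j\<in>B. prob (E k) * prob (E j)) + \<eta>"
proof -
  let ?W = "I - B"
  have finB: "finite B" using fin B by (rule finite_subset[rotated])
  have finW: "finite ?W" using fin by simp
  have evW: "\<And>j. j \<in> ?W \<Longrightarrow> E j \<in> events" using ev by simp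
  have evk: "E k \<in> events" using ev k by simp
  define a where "a = (CLINT x|M. indicator (E k) x *\<^sub>R iexp (u * hits E I x))"
  define b where "b = (CLINT x|M. indicator (E k) x *\<^sub>R iexp (u * (hits E ?W x + 1)))"
  define c where "c = (CLINT x|M. iexp (u * hits E ?W x))"
  define f where "f = (CLINT x|M. iexp (u * hits E I x))"
  have ia: "integrable M (\<lambda>x. indicator (E k) x *\<^sub>R iexp (u * hits E I x))"
    using has_integral_hits[OF fin ev evk, where g = "\<lambda>w. iexp (u * real w)"] by (simp add: has_bochner_integral_iff)
  have hb: "has_bochner_integral M (\<lambda>x. indicator (E k) x *\<^sub>R iexp (u * (hits E ?W x + 1)))
      (\<Sum>w\<le>card ?W. prob (E k \<inter> {x\<in>space M. hits E ?W x = w}) *\<^sub>R iexp (u * (w + 1)))"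
    using has_integral_hits[where I = ?W and E = E and A = "E k", OF finW evW evk, where g = "\<lambda>w. iexp (u * real (w + 1))"]
    by (simp add: add.commute)
  have hspace: "has_bochner_integral M (\<lambda>x. g (hits E J x))
      (\<Sum>w\<le>card J. prob {x\<in>space M. hits E J x = w} *\<^sub>R g w)"
    if "J \<subseteq> I" for J and g :: "nat \<Rightarrow> complex"
  proof (rule has_bochner_integral_cong[THEN iffD1, OF refl _ _ has_integral_hits[where I = J and E = E and A = "space M" and g = g]])
    show "finite J" using that fin by (rule finite_subset)
    show "E j \<in> events" if "j \<in> J" for j using ev that \<open>J \<subseteq> I\<close> by auto
    show "(\<Sum>w\<le>card J. prob (space M \<inter> {x \<in> space M. hits E J x = w}) *\<^sub>R g w)
      = (\<Sum>w\<le>card J. prob {x\<in>space M. hits E J x = w} *\<^sub>R g w)"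
      by (intro sum.cong refl) (auto intro!: arg_cong2[where f = scaleR] arg_cong[where f = prob])
  qed auto
  have hc: "has_bochner_integral M (\<lambda>x. iexp (u * hits E ?W x))
      (\<Sum>w\<le>card ?W. prob {x\<in>space M. hits E ?W x = w} *\<^sub>R iexp (u * w))"
    by (rule hspace) auto
  have hf: "integrable M (\<lambda>x. iexp (u * hits E I x))"
    using hspace[of I "\<lambda>w. iexp (u * real w)"] by (simp add: has_bochner_integral_iff)
  have "cmod (a - b) \<le> 2 * (\<Sum>j\<in>B - {k}. prob (E k \<inter> E j))"
  proof -
    have "a - b = (CLINT x|M. indicator (E k) x *\<^sub>R iexp (u * hits E I x)
        - indicator (E k) x *\<^sub>R iexp (u * (hits E ?W x + 1)))"
      unfolding a_def b_def using ia hb by (simp add: has_bochner_integral_iff)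
    also have "cmod \<dots> \<le> (LINT x|M. 2 * (\<Sum>j\<in>B - {k}. indicator (E k \<inter> E j) x))"
    proof (rule integral_norm_le_integral)
      show "integrable M (\<lambda>x. 2 * (\<Sum>j\<in>B - {k}. indicator (E k \<inter> E j) x) :: real)"
        using ev B k by (intro integrable_mult_right Bochner_Integration.integrable_sum)
          (auto simp: integrable_indicator_iff emeasure_eq_measure)
      fix x assume "x \<in> space M"
      show "cmod (indicator (E k) x *\<^sub>R iexp (u * hits E I x)
        - indicator (E k) x *\<^sub>R iexp (u * (hits E ?W x + 1)))
         \<le> 2 * (\<Sum>j\<in>B - {k}. indicator (E k \<inter> E j) x)"
      proof (cases "x \<in> E k \<and> (\<exists>j\<in>B - {k}. x \<in> E j)")
        case True
        then obtain j where j: "j \<in> B - {k}" "x \<in> E j" by auto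
        have "(1::real) = indicator (E k \<inter> E j) x"
          using True j by simp
        also have "\<dots> \<le> (\<Sum>j\<in>B - {k}. indicator (E k \<inter> E j) x)"
          using j finB by (intro member_le_sum) auto
        finally have "2 \<le> 2 * (\<Sum>j\<in>B - {k}. indicator (E k \<inter> E j) x :: real)"
          by simp
        then show ?thesis
          using True cmod_iexp_diff_le[of "u * hits E I x" "u * (hits E ?W x + 1)"]
          by (simp add: indicator_def)
      next
        case False
        have "x \<in> E k \<Longrightarrow> hits E I x = hits E ?W x + 1"
          using False k B by (intro hits_mono_diff fin) auto
        then show ?thesis
          by (cases "x \<in> E k") (auto intro!: sum_nonneg)
      qed
    qed (use ia hb in \<open>auto simp: has_bochner_integral_iff\<close>)
    also have "\<dots> = 2 * (\<Sum>j\<in>B - {k}. prob (E k \<inter> E j))"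
      using ev B k
      by (subst Bochner_Integration.integral_mult_right_zero, subst Bochner_Integration.integral_sum)
         (auto simp: integrable_indicator_iff emeasure_eq_measure intro!: sum.cong
               arg_cong[where f = prob] dest: sets.sets_into_space)
    finally show ?thesis .
  qed
  moreover have "cmod (b - prob (E k) *\<^sub>R (iexp u * c)) \<le> \<eta>"
  proof -
    have "b - prob (E k) *\<^sub>R (iexp u * c)
      = (\<Sum>w\<le>card ?W. (prob (E k \<inter> {x\<in>space M. hits E ?W x = w})
           - prob (E k) * prob {x\<in>space M. hits E ?W x = w}) *\<^sub>R iexp (u * (w + 1)))"
      using hb hc unfolding b_def c_def has_bochner_integral_iff
      by (simp add: sum_distrib_left scaleR_sum_right sum_subtractf[symmetric] scaleR_diff_left
          algebra_simps exp_add)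
    also have "cmod \<dots> \<le> (\<Sum>w\<le>card ?W. \<bar>prob (E k \<inter> {x\<in>space M. hits E ?W x = w})
           - prob (E k) * prob {x\<in>space M. hits E ?W x = w}\<bar>)"
      by (rule order_trans[OF norm_sum]) (auto intro!: sum_mono)
    finally show ?thesis using \<eta> by simp
  qed
  moreover have "cmod (prob (E k) *\<^sub>R (iexp u * c) - prob (E k) *\<^sub>R (iexp u * f))
     \<le> 2 * (\<Sum>j\<in>B. prob (E k) * prob (E j))"
  proof -
    have "c - f = (CLINT x|M. iexp (u * hits E ?W x) - iexp (u * hits E I x))"
      unfolding c_def f_def using hc hf by (simp add: has_bochner_integral_iff)
    also have "cmod \<dots> \<le> (LINT x|M. 2 * (\<Sum>j\<in>B. indicator (E j) x))"
    proof (rule integral_norm_le_integral)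
      show "integrable M (\<lambda>x. 2 * (\<Sum>j\<in>B. indicator (E j) x) :: real)"
        using ev B k by (intro integrable_mult_right Bochner_Integration.integrable_sum)
          (auto simp: integrable_indicator_iff emeasure_eq_measure)
      fix x assume "x \<in> space M"
      show "cmod (iexp (u * hits E ?W x) - iexp (u * hits E I x)) \<le> 2 * (\<Sum>j\<in>B. indicator (E j) x)"
      proof (cases "\<exists>j\<in>B. x \<in> E j")
        case True
        then obtain j where j: "j \<in> B" "x \<in> E j" by auto
        have "(1::real) = indicator (E j) x"
          using True j by simp
        also have "\<dots> \<le> (\<Sum>j\<in>B. indicator (E j) x)"
          using j finB by (intro member_le_sum) auto
        finally show ?thesis
          using True cmod_iexp_diff_le[of "u * hits E ?W x" "u * hits E I x"]
          by simp
      next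
        case False
        then have "hits E ?W x = hits E I x"
          by (intro hits_diff_eq) auto
        then show ?thesis
          by (auto intro!: sum_nonneg)
      qed
    qed (use hc hf in \<open>auto simp: has_bochner_integral_iff\<close>)
    also have "\<dots> = 2 * (\<Sum>j\<in>B. prob (E j))"
      using ev B k
      by (subst Bochner_Integration.integral_mult_right_zero, subst Bochner_Integration.integral_sum)
         (auto simp: integrable_indicator_iff emeasure_eq_measure intro!: sum.cong
               arg_cong[where f = prob] dest: sets.sets_into_space)
    finally have *: "cmod (c - f) \<le> 2 * (\<Sum>j\<in>B. prob (E j))" .
    have "prob (E k) *\<^sub>R (iexp u * c) - prob (E k) *\<^sub>R (iexp u * f) = prob (E k) *\<^sub>R (iexp u * (c - f))"
      by (simp add: algebra_simps scaleR_diff_right)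
    then have "cmod (prob (E k) *\<^sub>R (iexp u * c) - prob (E k) *\<^sub>R (iexp u * f)) = prob (E k) * cmod (c - f)"
      by (simp add: norm_mult)
    also have "\<dots> \<le> prob (E k) * (2 * (\<Sum>j\<in>B. prob (E j)))"
      using * by (intro mult_left_mono) auto
    finally show ?thesis by (simp add: sum_distrib_left mult_ac)
  qed
  ultimately show ?thesis
    unfolding a_def[symmetric] f_def[symmetric]
    by (smt (verit, best) norm_triangle_ineq diff_add_cancel add_diff_eq)
qed

text \<open>Differentiating the characteristic function brings down the factor
  \<open>hits E I x\<close>, which is the sum of the indicators of the \<open>E k\<close>. Hence
  \<open>hit_term_approx\<close>, summed over \<open>k\<close>, is a linear differential equation
  with perturbation \<open>err\<close>, solved by an integrating factor and the mean value
  inequality.\<close>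

lemma poisson_char_approx:
  fixes u :: real
  assumes fin: "finite I" and ev: "\<And>j. j \<in> I \<Longrightarrow> E j \<in> events"
    and B: "\<And>k. k \<in> I \<Longrightarrow> k \<in> B k" "\<And>k. k \<in> I \<Longrightarrow> B k \<subseteq> I"
    and \<eta>: "\<And>k. k \<in> I \<Longrightarrow>
      (\<Sum>w\<le>card (I - B k). \<bar>prob (E k \<inter> {x\<in>space M. hits E (I - B k) x = w})
             - prob (E k) * prob {x\<in>space M. hits E (I - B k) x = w}\<bar>) \<le> \<eta> k"
  defines "\<Lambda> \<equiv> \<Sum>k\<in>I. prob (E k)"
  defines "err \<equiv> 2 * (\<Sum>k\<in>I. \<Sum>j\<in>B k - {k}. prob (E k \<inter> E j))
      + 2 * (\<Sum>k\<in>I. \<Sum>j\<in>B k. prob (E k) * prob (E j)) + (\<Sum>k\<in>I. \<eta> k)"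
  shows "cmod ((CLINT x|M. iexp (u * hits E I x)) - exp (\<Lambda> * (iexp u - 1)))
    \<le> err * exp (2 * \<Lambda>) * \<bar>u\<bar>"
proof -
  define \<phi> where "\<phi> u = (CLINT x|M. iexp (u * hits E I x))" for u :: real
  define p where "p w = prob {x\<in>space M. hits E I x = w}" for w
  have hI: "has_bochner_integral M (\<lambda>x. g (hits E I x)) (\<Sum>w\<le>card I. p w *\<^sub>R g w)"
    for g :: "nat \<Rightarrow> complex"
  proof (rule has_bochner_integral_cong[THEN iffD1, OF refl _ _ has_integral_hits[OF fin ev sets.top, where g = g]])
    show "(\<Sum>w\<le>card I. prob (space M \<inter> {x \<in> space M. hits E I x = w}) *\<^sub>R g w)
      = (\<Sum>w\<le>card I. p w *\<^sub>R g w)"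
      unfolding p_def by (intro sum.cong refl) (auto intro!: arg_cong2[where f = scaleR] arg_cong[where f = prob])
  qed auto
  have \<phi>_sum: "\<phi> = (\<lambda>u::real. \<Sum>w\<le>card I. p w *\<^sub>R iexp (u * w))"
    unfolding \<phi>_def using hI[of "\<lambda>w. iexp (u * real w)" for u] by (auto simp: has_bochner_integral_iff)
  define D where "D u = (\<Sum>k\<in>I. CLINT x|M. indicator (E k) x *\<^sub>R iexp (u * hits E I x))" for u :: real
  have D_sum: "D u = (\<Sum>w\<le>card I. p w *\<^sub>R (of_nat w * iexp (u * w)))" for u
  proof -
    have ik: "integrable M (\<lambda>x. indicator (E k) x *\<^sub>R iexp (u * hits E I x))" if "k \<in> I" for k
      using has_integral_hits[OF fin ev ev[OF that], where g = "\<lambda>w. iexp (u * real w)"]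
      by (simp add: has_bochner_integral_iff)
    have "D u = (CLINT x|M. (\<Sum>k\<in>I. indicator (E k) x *\<^sub>R iexp (u * hits E I x)))"
      unfolding D_def using ik by (intro Bochner_Integration.integral_sum[symmetric])
    also have "\<dots> = (CLINT x|M. of_nat (hits E I x) * iexp (u * hits E I x))"
    proof (intro Bochner_Integration.integral_cong refl)
      fix x
      have "(\<Sum>k\<in>I. indicator (E k) x *\<^sub>R iexp (u * hits E I x))
        = (\<Sum>k\<in>I. indicator (E k) x :: real) *\<^sub>R iexp (u * hits E I x)"
        by (simp add: scaleR_sum_left)
      also have "(\<Sum>k\<in>I. indicator (E k) x :: real) = real (hits E I x)"
        by (simp add: hits_eq_sum[OF fin] real_of_nat_indicator)
      finally show "(\<Sum>k\<in>I. indicator (E k) x *\<^sub>R iexp (u * hits E I x))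
        = of_nat (hits E I x) * iexp (u * hits E I x)"
        by (simp add: scaleR_conv_of_real)
    qed
    also have "\<dots> = (\<Sum>w\<le>card I. p w *\<^sub>R (of_nat w * iexp (u * w)))"
      using hI[of "\<lambda>w. of_nat w * iexp (u * real w)"] by (simp add: has_bochner_integral_iff)
    finally show ?thesis .
  qed
  have d\<phi>: "(\<phi> has_vector_derivative \<i> * D u) (at u)" for u
  proof -
    have 1: "((\<lambda>u. iexp (u * real w)) has_vector_derivative real w *\<^sub>R (\<i> * iexp (u * real w))) (at u)" for w
    proof -
      have "((\<lambda>u. u * real w) has_vector_derivative real w) (at u)"
        by (auto intro!: derivative_eq_intros simp flip: has_real_derivative_iff_has_vector_derivative)
      from vector_diff_chain_at[OF this has_vector_derivative_iexp] show ?thesis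
        by (simp add: o_def)
    qed
    have "(\<phi> has_vector_derivative (\<Sum>w\<le>card I. p w *\<^sub>R (real w *\<^sub>R (\<i> * iexp (u * real w))))) (at u)"
      unfolding \<phi>_sum
      by (intro has_vector_derivative_sum bounded_linear.has_vector_derivative[OF bounded_linear_scaleR_right] 1)
    then show ?thesis
      unfolding D_sum by (simp add: sum_distrib_left mult_ac scaleR_conv_of_real)
  qed
  have err: "cmod (D u - \<Lambda> * (iexp u * \<phi> u)) \<le> err" for u
  proof -
    have "D u - \<Lambda> * (iexp u * \<phi> u)
       = (\<Sum>k\<in>I. (CLINT x|M. indicator (E k) x *\<^sub>R iexp (u * hits E I x))
           - prob (E k) *\<^sub>R (iexp u * (CLINT x|M. iexp (u * hits E I x))))"
      unfolding D_def \<phi>_def \<Lambda>_def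
      by (simp add: sum_subtractf sum_distrib_right scaleR_conv_of_real)
    also have "cmod \<dots> \<le> (\<Sum>k\<in>I. 2 * (\<Sum>j\<in>B k - {k}. prob (E k \<inter> E j))
        + 2 * (\<Sum>j\<in>B k. prob (E k) * prob (E j)) + \<eta> k)"
      using assms by (intro order_trans[OF norm_sum] sum_mono hit_term_approx) auto
    also have "\<dots> = err"
      unfolding err_def by (simp add: sum.distrib sum_distrib_left)
    finally show ?thesis .
  qed
  have \<Lambda>: "\<Lambda> \<ge> 0" unfolding \<Lambda>_def by (intro sum_nonneg) auto
  have err0: "err \<ge> 0" using err[of 0] norm_ge_zero order_trans by blast
  \<comment> \<open>The characteristic function divided by the Poisson solution: \<open>h\<close>
    would be constantly 1 if \<open>err\<close> were 0.\<close>
  define h where "h u = \<phi> u * exp (- \<Lambda> * (iexp u - 1))" for u :: real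
  define h' where "h' u = \<i> * (D u - \<Lambda> * (iexp u * \<phi> u)) * exp (- \<Lambda> * (iexp u - 1))" for u :: real
  have dexp: "((\<lambda>u. exp (- \<Lambda> * (iexp u - 1))) has_vector_derivative
      (- \<Lambda> * (\<i> * iexp u)) * exp (- \<Lambda> * (iexp u - 1))) (at u)" for u :: real
  proof -
    have 1: "((\<lambda>u. - \<Lambda> * (iexp u - 1)) has_vector_derivative (- \<Lambda> * (\<i> * iexp u))) (at u)"
      by (auto intro!: derivative_eq_intros)
    show ?thesis
      using field_vector_diff_chain_at[OF 1 DERIV_exp] by (simp add: o_def)
  qed
  have dh: "(h has_vector_derivative h' u) (at u)" for u
  proof -
    have "((\<lambda>u. \<phi> u * exp (- \<Lambda> * (iexp u - 1))) has_vector_derivative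
       \<phi> u * ((- \<Lambda> * (\<i> * iexp u)) * exp (- \<Lambda> * (iexp u - 1))) + \<i> * D u * exp (- \<Lambda> * (iexp u - 1))) (at u)"
      by (intro has_vector_derivative_mult d\<phi> dexp)
    then show ?thesis
      unfolding h_def[abs_def] h'_def by (simp add: algebra_simps)
  qed
  have ne: "cmod (exp (- \<Lambda> * (iexp u - 1))) \<le> exp (2 * \<Lambda>)" for u
  proof -
    have "\<Lambda> * (1 - cos u) \<le> \<Lambda> * 2"
      using \<Lambda> cos_ge_minus_one[of u] by (intro mult_left_mono) auto
    then show ?thesis by (simp add: norm_exp_eq_Re Re_exp algebra_simps)
  qed
  have nh: "cmod (h' u) \<le> err * exp (2 * \<Lambda>)" for u
    unfolding h'_def norm_mult using err[of u] ne[of u] err0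
    by (simp add: mult_mono')
  have "cmod (h u - h 0) \<le> (err * exp (2 * \<Lambda>)) * norm (u - 0)"
  proof (rule differentiable_bound[OF convex_UNIV])
    show "(h has_derivative (\<lambda>x. x *\<^sub>R h' v)) (at v within UNIV)" for v
      using dh[of v] by (simp add: has_vector_derivative_def)
    show "onorm (\<lambda>x. x *\<^sub>R h' v) \<le> err * exp (2 * \<Lambda>)" for v
      using nh[of v] by (intro onorm_le) (simp add: mult.commute mult_left_mono)
  qed auto
  moreover have "h 0 = 1"
    unfolding h_def \<phi>_def by (simp add: prob_space)
  ultimately have hu: "cmod (h u - 1) \<le> err * exp (2 * \<Lambda>) * \<bar>u\<bar>" by simp
  have "\<phi> u - exp (\<Lambda> * (iexp u - 1)) = (h u - 1) * exp (\<Lambda> * (iexp u - 1))"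
    unfolding h_def by (simp add: algebra_simps flip: exp_add)
  then have "cmod (\<phi> u - exp (\<Lambda> * (iexp u - 1))) = cmod (h u - 1) * cmod (exp (\<Lambda> * (iexp u - 1)))"
    by (simp add: norm_mult)
  \<comment> \<open>Undoing the division costs nothing, since
    \<open>\<Lambda> * (iexp u - 1)\<close> has real part
    \<open>\<Lambda> * (cos u - 1) \<le> 0\<close>.\<close>
  also have "\<dots> \<le> cmod (h u - 1) * 1"
    using \<Lambda> by (intro mult_left_mono) (auto simp: norm_exp_eq_Re Re_exp mult_le_0_iff)
  finally show ?thesis
    using hu unfolding \<phi>_def by simp
qed

end

lemma char_poisson:
  assumes "t > 0"
  shows "char (distr (measure_pmf (poisson_pmf t)) borel real) u = exp (t * (iexp u - 1))"
proof -
  have "char (distr (measure_pmf (poisson_pmf t)) borel real) u = (CLINT k|measure_pmf (poisson_pmf t). iexp (u * real k))"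
    unfolding char_def by (subst integral_distr) auto
  also have "\<dots> = (CLINT k|count_space UNIV. pmf (poisson_pmf t) k *\<^sub>R iexp (u * real k))"
    unfolding measure_pmf_eq_density by (subst integral_density) (auto simp: pmf_nonneg)
  also have "\<dots> = exp (t * (iexp u - 1))"
  proof (rule sums_unique2[OF sums_integral_count_space_nat])
    have "integrable (measure_pmf (poisson_pmf t)) (\<lambda>k. iexp (u * real k))"
      by (rule measure_pmf.integrable_const_bound[where B = 1]) auto
    then show "integrable (count_space UNIV) (\<lambda>k. pmf (poisson_pmf t) k *\<^sub>R iexp (u * real k))"
      unfolding measure_pmf_eq_density by (subst (asm) integrable_density) (auto simp: pmf_nonneg)
    have "(\<lambda>k. exp (- t) * ((t * iexp u) ^ k /\<^sub>R fact k)) sums (exp (- t) * exp (t * iexp u))"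
      by (intro sums_mult exp_converges)
    moreover have "complex_of_real (exp (- t)) * ((t * iexp u) ^ k /\<^sub>R fact k)
         = pmf (poisson_pmf t) k *\<^sub>R iexp (u * real k)" for k
      using assms
      by (simp add: scaleR_conv_of_real power_mult_distrib exp_of_nat_mult[symmetric] field_simps)
    moreover have "complex_of_real (exp (- t)) * exp (t * iexp u) = exp (t * (iexp u - 1))"
      by (simp add: exp_of_real[symmetric] exp_add[symmetric] algebra_simps)
    ultimately show "(\<lambda>k. pmf (poisson_pmf t) k *\<^sub>R iexp (u * real k)) sums exp (t * (iexp u - 1))"
      by (simp del: pmf_poisson)
  qed
  finally show ?thesis .
qed

section \<open>Finitely determined events under mixing\<close>

definition depends_on :: "nat set \<Rightarrow> (nat \<Rightarrow> 'a) set \<Rightarrow> bool" where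
  "depends_on J B \<longleftrightarrow> (\<forall>x y. (\<forall>i\<in>J. x i = y i) \<longrightarrow> x \<in> B \<longrightarrow> y \<in> B)"

text \<open>A cylinder over an arbitrary coordinate set, possibly with gaps: these are the atoms of
  the events that depend on \<open>J\<close>.\<close>

definition agree :: "(nat \<Rightarrow> 'a) \<Rightarrow> nat set \<Rightarrow> (nat \<Rightarrow> 'a) set" where
  "agree v J = {x. \<forall>i\<in>J. x i = v i}"

lemma depends_onI:
  assumes "\<And>x y. (\<And>i. i \<in> J \<Longrightarrow> x i = y i) \<Longrightarrow> x \<in> B \<Longrightarrow> y \<in> B"
  shows "depends_on J B"
  unfolding depends_on_def by (intro allI impI) (rule assms, auto)

lemma depends_onD:
  assumes "depends_on J B" "\<And>i. i \<in> J \<Longrightarrow> x i = y i"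
  shows "x \<in> B \<longleftrightarrow> y \<in> B"
  using assms(1)[unfolded depends_on_def, rule_format, of x y]
    assms(1)[unfolded depends_on_def, rule_format, of y x] assms(2) by auto

lemma depends_on_Int:
  assumes "depends_on J B" "depends_on K C"
  shows "depends_on (J \<union> K) (B \<inter> C)"
proof (rule depends_onI)
  fix x y assume "\<And>i. i \<in> J \<union> K \<Longrightarrow> x i = y i" "x \<in> B \<inter> C"
  then show "y \<in> B \<inter> C"
    using depends_onD[OF assms(1), of x y] depends_onD[OF assms(2), of x y] by auto
qed

lemma depends_on_INT:
  assumes "\<And>i. i \<in> I \<Longrightarrow> depends_on (J i) (B i)"
  shows "depends_on (\<Union>i\<in>I. J i) (\<Inter>i\<in>I. B i)"
  unfolding depends_on_def
proof (intro allI impI INT_I)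
  fix x y i assume "\<forall>i\<in>\<Union>i\<in>I. J i. x i = y i" "x \<in> (\<Inter>i\<in>I. B i)" "i \<in> I"
  then show "y \<in> B i"
    using depends_onD[OF assms, of i x y] by auto
qed

lemma depends_on_agree: "depends_on J (agree v J)"
  unfolding depends_on_def agree_def by simp

lemma agree_Un: "agree v (J \<union> K) = agree v J \<inter> agree v K"
  unfolding agree_def by auto

lemma depends_on_empty: "depends_on {} B \<Longrightarrow> B = {} \<or> B = UNIV"
  using depends_onD[of "{}" B] by auto

lemma left_shift_funpow: "(left_shift ^^ k) x = (\<lambda>i. x (i + k))"
  by (induction k) (auto simp: left_shift_def)

lemma depends_on_shift:
  assumes "depends_on J B"
  shows "depends_on ((\<lambda>i. i + k) ` J) ((left_shift ^^ k) -` B)"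
  unfolding depends_on_def
proof (intro allI impI)
  fix x y assume "\<forall>i\<in>(\<lambda>i. i + k) ` J. x i = y i" "x \<in> (left_shift ^^ k) -` B"
  then show "y \<in> (left_shift ^^ k) -` B"
    using depends_onD[OF assms, of "(left_shift ^^ k) x" "(left_shift ^^ k) y"]
    by (simp add: left_shift_funpow)
qed

text \<open>An atom is represented by a point of \<open>B\<close> made \<open>undefined\<close> off
  \<open>J\<close>, so different representatives give disjoint atoms. Finiteness of \<open>J\<close>
  over a countable alphabet keeps their number countable.\<close>

lemma depends_on_UN_agree:
  fixes B :: "(nat \<Rightarrow> 'a::countable) set"
  assumes "finite J" "depends_on J B"
  obtains V where "countable V" "disjoint_family_on (\<lambda>v. agree v J) V" "B = (\<Union>v\<in>V. agree v J)"
proof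
  let ?V = "(\<lambda>x. restrict x J) ` B"
  have "?V \<subseteq> J \<rightarrow>\<^sub>E UNIV" by auto
  then show "countable ?V"
    using assms(1) by (elim countable_subset) (intro countable_PiE, auto)
  show "disjoint_family_on (\<lambda>v. agree v J) ?V"
    unfolding disjoint_family_on_def
  proof (intro ballI impI)
    have *: "v = restrict z J" if "v \<in> ?V" "z \<in> agree v J" for v z
      using that by (auto simp: agree_def fun_eq_iff)
    fix v w assume "v \<in> ?V" "w \<in> ?V" "v \<noteq> w"
    then show "agree v J \<inter> agree w J = {}"
      using *[of v] *[of w] by (metis disjoint_iff)
  qed
  show "B = (\<Union>v\<in>?V. agree v J)"
  proof (safe, goal_cases)
    case (1 x)
    then show ?case by (auto simp: agree_def intro!: bexI[of _ x])
  next
    case (2 x _ y)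
    then show ?case using depends_onD[OF assms(2), of x y] by (auto simp: agree_def)
  qed
qed

lemma depends_on_coord_algebra:
  fixes B :: "(nat \<Rightarrow> 'a::countable) set"
  assumes "finite J" "depends_on J B" "\<And>i. i \<in> J \<Longrightarrow> k \<le> i \<and> enat i \<le> n"
  shows "B \<in> coord_algebra k n"
proof -
  let ?G = "{(\<lambda>\<omega>. \<omega> i) -` S | i S. k \<le> i \<and> enat i \<le> n} :: (nat \<Rightarrow> 'a) set set"
  interpret sigma_algebra UNIV "coord_algebra k n :: (nat \<Rightarrow> 'a) set set"
    unfolding coord_algebra_def by (rule sigma_algebra_sigma_sets) auto
  obtain V where V: "countable V" "B = (\<Union>v\<in>V. agree v J)"
    using depends_on_UN_agree[OF assms(1,2)] by metis
  have "agree v J \<in> coord_algebra k n" for v :: "nat \<Rightarrow> 'a"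
  proof -
    have "agree v J = (\<Inter>i\<in>J. (\<lambda>\<omega>. \<omega> i) -` {v i})"
      unfolding agree_def by auto
    also have "\<dots> \<in> coord_algebra k n"
    proof (rule countable_INT'')
      show "(\<lambda>\<omega>. \<omega> i) -` {v i} \<in> coord_algebra k n" if "i \<in> J" for i
        unfolding coord_algebra_def using assms(3)[OF that] by (intro sigma_sets.Basic) blast
    qed (use assms(1) in \<open>auto simp: coord_algebra_def sigma_sets_top countable_finite\<close>)
    finally show ?thesis .
  qed
  then show ?thesis
    unfolding V(2) using V(1) by (intro countable_UN') auto
qed

lemma depends_on_cylinder_sets:
  fixes B :: "(nat \<Rightarrow> 'a::countable) set"
  assumes "finite J" "depends_on J B"
  shows "B \<in> sets cylinder_space"
proof -
  obtain n where n: "J \<subseteq> {..<n}"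
    using assms(1) finite_nat_iff_bounded by blast
  let ?W = "(\<lambda>x. map x [0..<n]) ` B"
  have "B = (\<Union>w\<in>?W. cylinder w)"
  proof (safe, goal_cases)
    case (1 x)
    then show ?case by (auto simp: cylinder_def intro!: bexI[of _ x])
  next
    case (2 x _ y)
    then show ?case using depends_onD[OF assms(2), of x y] n by (auto simp: cylinder_def subset_iff)
  qed
  also have "\<dots> \<in> sets cylinder_space"
    by (intro sets.countable_UN') (auto simp: cylinder_space_def)
  finally show ?thesis .
qed

lemma depends_on_cylinder: "depends_on {..<length w} (cylinder w)"
  unfolding depends_on_def cylinder_def by auto

text \<open>
  Only finitely determined events occur, so \<open>\<psi>\<close>-mixing enters through this symmetric
  multiplicative form, with \<open>c\<close> close to 1 for large \<open>m\<close>.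
\<close>

definition mixes_up :: "(nat \<Rightarrow> 'a) measure \<Rightarrow> nat \<Rightarrow> real \<Rightarrow> bool" where
  "mixes_up P m c \<longleftrightarrow> (\<forall>J K B C. finite J \<longrightarrow> finite K \<longrightarrow> depends_on J B \<longrightarrow> depends_on K C \<longrightarrow>
     (\<forall>i\<in>J. \<forall>j\<in>K. i + m < j) \<longrightarrow> measure P (B \<inter> C) \<le> c * (measure P B * measure P C))"

definition mixes_low :: "(nat \<Rightarrow> 'a) measure \<Rightarrow> nat \<Rightarrow> real \<Rightarrow> bool" where
  "mixes_low P m c \<longleftrightarrow> (\<forall>J K B C. finite J \<longrightarrow> finite K \<longrightarrow> depends_on J B \<longrightarrow> depends_on K C \<longrightarrow>
     (\<forall>i\<in>J. \<forall>j\<in>K. i + m < j) \<longrightarrow> measure P B * measure P C \<le> c * measure P (B \<inter> C))"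

locale shift_space = prob_space P for P :: "(nat \<Rightarrow> 'a::countable) measure" +
  assumes sets_P: "sets P = sets cylinder_space"
    and shift_P: "distr P P left_shift = P"
begin

lemma space_P [simp]: "space P = UNIV"
  using sets_eq_imp_space_eq[OF sets_P] by (simp add: cylinder_space_def)

lemma depends_on_events: "finite J \<Longrightarrow> depends_on J B \<Longrightarrow> B \<in> events"
  unfolding sets_P by (rule depends_on_cylinder_sets)

lemma measurable_left_shift: "left_shift \<in> measurable P P"
proof (rule measurable_sigma_sets[where A = "range cylinder" and \<Omega> = UNIV])
  show "sets P = sigma_sets UNIV (range cylinder)"
    unfolding sets_P by (simp add: cylinder_space_def)
  fix y :: "(nat \<Rightarrow> 'a) set" assume "y \<in> range cylinder"
  then obtain w where w: "y = cylinder w" by auto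
  have "left_shift -` y \<inter> space P = (left_shift ^^ 1) -` cylinder w"
    using w by auto
  also have "\<dots> \<in> events"
    by (rule depends_on_events[OF _ depends_on_shift[OF depends_on_cylinder]]) auto
  finally show "left_shift -` y \<inter> space P \<in> events" .
qed auto

lemma prob_shift:
  assumes "B \<in> events"
  shows "(left_shift ^^ k) -` B \<in> events \<and> prob ((left_shift ^^ k) -` B) = prob B"
proof (induction k)
  case 0
  then show ?case using assms by simp
next
  case (Suc k)
  have *: "(left_shift ^^ Suc k) -` B = left_shift -` ((left_shift ^^ k) -` B)"
    by (simp only: funpow_Suc_right) auto
  have "prob (left_shift -` ((left_shift ^^ k) -` B)) = measure (distr P P left_shift) ((left_shift ^^ k) -` B)"
    using Suc by (subst measure_distr[OF measurable_left_shift]) auto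
  moreover have "left_shift -` ((left_shift ^^ k) -` B) \<in> events"
    using measurable_sets[OF measurable_left_shift conjunct1[OF Suc]] by simp
  ultimately show ?case
    using Suc unfolding * shift_P by simp
qed

text \<open>The cut between past and future is placed at the largest coordinate of \<open>J\<close>,
  which is the \<open>n\<close> of the supremum in \<open>psi_coeff\<close>. Multiplying out the
  quotient also admits null events.\<close>

lemma psi_coeff_bound:
  assumes "psi_coeff P m \<le> ennreal \<delta>" "\<delta> \<ge> 0" and fin: "finite J" "finite K"
    and dep: "depends_on J B" "depends_on K C" and sep: "\<forall>i\<in>J. \<forall>j\<in>K. i + m < j"
  shows "\<bar>prob (B \<inter> C) - prob B * prob C\<bar> \<le> \<delta> * (prob B * prob C)"
proof (cases "J = {}")
  \<comment> \<open>Without coordinates there is no maximum to cut at, but then \<open>B\<close> is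
    trivial.\<close>
  case True
  then have "B = {} \<or> B = UNIV" using dep depends_on_empty by blast
  then show ?thesis using assms(2) prob_space by auto
next
  case False
  define a where "a = Max J"
  have B: "B \<in> coord_algebra 0 (enat a)"
    using fin by (intro depends_on_coord_algebra[OF _ dep(1)]) (auto simp: a_def)
  have "a \<in> J" unfolding a_def using fin False by simp
  then have C: "C \<in> coord_algebra (a + m + 1) \<infinity>"
    using fin sep by (intro depends_on_coord_algebra[OF _ dep(2)]) force+
  have ev: "B \<in> events" "C \<in> events"
    using depends_on_events fin dep by auto
  show ?thesis
  proof (cases "prob B * prob C = 0")
    \<comment> \<open>\<open>psi_dep\<close> skips pairs with vanishing product; for these the
      intersection is null as well.\<close>
    case True
    moreover have "prob (B \<inter> C) \<le> prob B" "prob (B \<inter> C) \<le> prob C"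
      using ev by (auto intro!: finite_measure_mono)
    ultimately have "prob (B \<inter> C) = 0"
      using measure_nonneg[of P "B \<inter> C"] by (auto simp del: measure_nonneg)
    then show ?thesis by (simp only: True)
  next
    case False
    then have "ennreal \<bar>prob (B \<inter> C) / (prob B * prob C) - 1\<bar>
      \<le> psi_dep P (coord_algebra 0 (enat a)) (coord_algebra (a + m + 1) \<infinity>)"
      unfolding psi_dep_def using B C by (intro Sup_upper) auto
    also have "\<dots> \<le> psi_coeff P m"
      unfolding psi_coeff_def by (intro SUP_upper) auto
    also have "\<dots> \<le> ennreal \<delta>" by fact
    finally have "\<bar>prob (B \<inter> C) / (prob B * prob C) - 1\<bar> \<le> \<delta>"
      using assms(2) by (simp add: ennreal_le_iff)
    then have "\<bar>prob (B \<inter> C) / (prob B * prob C) - 1\<bar> * (prob B * prob C) \<le> \<delta> * (prob B * prob C)"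
      by (intro mult_right_mono) auto
    also have "\<bar>prob (B \<inter> C) / (prob B * prob C) - 1\<bar> * (prob B * prob C)
       = \<bar>(prob (B \<inter> C) / (prob B * prob C) - 1) * (prob B * prob C)\<bar>"
      by (simp add: abs_mult)
    also have "(prob (B \<inter> C) / (prob B * prob C) - 1) * (prob B * prob C) = prob (B \<inter> C) - prob B * prob C"
      using False by (simp add: left_diff_distrib)
    finally show ?thesis .
  qed
qed

text \<open>This is where \<open>psi_coeff P 0 < \<infinity>\<close> enters. The constant need not
  be near 1, but no gap is required, as the pair estimates demand.\<close>

lemma psi_mixing_up:
  assumes "psi_mixing P"
  obtains K where "K \<ge> 1" "mixes_up P 0 K"
proof
  define \<delta> where "\<delta> = enn2real (psi_coeff P 0)"
  have \<delta>: "psi_coeff P 0 \<le> ennreal \<delta>"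
    using assms unfolding \<delta>_def psi_mixing_def by (simp add: less_top)
  have \<delta>0: "\<delta> \<ge> 0" unfolding \<delta>_def by simp
  show "1 + \<delta> \<ge> 1" using \<delta>0 by simp
  show "mixes_up P 0 (1 + \<delta>)"
    unfolding mixes_up_def
  proof (intro allI impI)
    fix J K and B C :: "(nat \<Rightarrow> 'a) set"
    assume *: "finite J" "finite K" "depends_on J B" "depends_on K C" "\<forall>i\<in>J. \<forall>j\<in>K. i + 0 < j"
    show "prob (B \<inter> C) \<le> (1 + \<delta>) * (prob B * prob C)"
      using psi_coeff_bound[OF \<delta> \<delta>0 *] by (simp add: algebra_simps abs_le_iff)
  qed
qed

lemma psi_mixing_close:
  assumes "psi_mixing P" "c > 1"
  obtains m where "mixes_up P m c" "mixes_low P m c"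
proof -
  \<comment> \<open>Chosen so that \<open>1 - \<delta> = 1 / c\<close>, which is what the lower
    bound needs; the upper bound \<open>1 + \<delta> \<le> c\<close> then follows from a square
    being nonnegative.\<close>
  define \<delta> where "\<delta> = (c - 1) / c"
  have \<delta>0: "\<delta> > 0" using assms unfolding \<delta>_def by simp
  have "psi_coeff P \<longlonglongrightarrow> 0" using assms unfolding psi_mixing_def by simp
  then have "\<forall>\<^sub>F m in sequentially. psi_coeff P m < ennreal \<delta>"
    using \<delta>0 by (intro order_tendstoD(2)) auto
  then obtain m where m: "psi_coeff P m \<le> ennreal \<delta>"
    by (auto simp: eventually_sequentially intro: less_imp_le)
  have 1: "c * (1 - \<delta>) = 1"
    using assms(2) unfolding \<delta>_def by (simp add: field_simps)
  have "0 \<le> (c - 1) * (c - 1) / c"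
    using assms(2) by (intro divide_nonneg_pos) auto
  also have "\<dots> = c - (1 + \<delta>)"
    using assms(2) unfolding \<delta>_def by (simp add: field_simps)
  finally have 2: "1 + \<delta> \<le> c" by simp
  show ?thesis
  proof
    show "mixes_up P m c"
      unfolding mixes_up_def
    proof (intro allI impI)
      fix J K and B C :: "(nat \<Rightarrow> 'a) set"
      assume *: "finite J" "finite K" "depends_on J B" "depends_on K C" "\<forall>i\<in>J. \<forall>j\<in>K. i + m < j"
      have "prob (B \<inter> C) \<le> (1 + \<delta>) * (prob B * prob C)"
        using psi_coeff_bound[OF m _ *] \<delta>0 by (simp add: algebra_simps abs_le_iff)
      also have "\<dots> \<le> c * (prob B * prob C)"
        using 2 by (intro mult_right_mono) auto
      finally show "prob (B \<inter> C) \<le> c * (prob B * prob C)" .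
    qed
    show "mixes_low P m c"
      unfolding mixes_low_def
    proof (intro allI impI)
      fix J K and B C :: "(nat \<Rightarrow> 'a) set"
      assume *: "finite J" "finite K" "depends_on J B" "depends_on K C" "\<forall>i\<in>J. \<forall>j\<in>K. i + m < j"
      have "(1 - \<delta>) * (prob B * prob C) \<le> prob (B \<inter> C)"
        using psi_coeff_bound[OF m _ *] \<delta>0 by (simp add: algebra_simps abs_le_iff)
      then have "c * ((1 - \<delta>) * (prob B * prob C)) \<le> c * prob (B \<inter> C)"
        using assms(2) by (intro mult_left_mono) auto
      then show "prob B * prob C \<le> c * prob (B \<inter> C)"
        using 1 by (simp add: mult.assoc[symmetric])
    qed
  qed
qed

end

text \<open>Arithmetic of one induction step of the decoupling. With \<open>E\<close> the earlier
  windows, \<open>W\<close> the new one, and \<open>L\<close>, \<open>K\<close> the parts of the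
  atom before and after it: \<open>x\<close> belongs to \<open>E L W K\<close>, \<open>y\<close> to
  \<open>E L W\<close>, \<open>z\<close> to \<open>E L\<close>, \<open>s\<close> to
  \<open>E W\<close>, \<open>r\<close> to \<open>L K\<close>, and \<open>e\<close>,
  \<open>w\<close>, \<open>l\<close>, \<open>k\<close> to the single sets. Two splits and two joins
  give \<open>c ^ 4\<close>.\<close>

lemma decouple_step_up:
  fixes c Q x y z w e l k s r :: real
  assumes "x \<le> c * (y * k)" "y \<le> c * (z * w)" "z \<le> Q * (e * l)" "e * w \<le> c * s" "l * k \<le> c * r"
    and nn: "0 \<le> c" "0 \<le> Q" "0 \<le> k" "0 \<le> w" "0 \<le> e" "0 \<le> l" "0 \<le> s"
  shows "x \<le> c ^ 4 * Q * (s * r)"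
proof -
  have "x \<le> c * ((c * ((Q * (e * l)) * w)) * k)"
    using assms(1) mult_left_mono[OF mult_right_mono[OF order_trans[OF assms(2)
      mult_left_mono[OF mult_right_mono[OF assms(3) nn(4)] nn(1)]] nn(3)] nn(1)]
    by simp
  also have "\<dots> = c ^ 2 * Q * ((e * w) * (l * k))"
    by (simp add: power2_eq_square algebra_simps)
  also have "\<dots> \<le> c ^ 2 * Q * ((c * s) * (c * r))"
    using nn by (intro mult_left_mono mult_mono[OF assms(4,5)]) auto
  also have "\<dots> = c ^ 4 * Q * (s * r)"
    by (simp add: power2_eq_square power4_eq_xxxx algebra_simps)
  finally show ?thesis .
qed

lemma decouple_step_low:
  fixes c Q x y z w e l k s r :: real
  assumes "y * k \<le> c * x" "z * w \<le> c * y" "e * l \<le> Q * z" "s \<le> c * (e * w)" "r \<le> c * (l * k)"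
    and nn: "0 \<le> c" "0 \<le> Q" "0 \<le> k" "0 \<le> w" "0 \<le> e" "0 \<le> l" "0 \<le> r"
  shows "s * r \<le> c ^ 4 * Q * x"
proof -
  have "s * r \<le> (c * (e * w)) * (c * (l * k))"
    using nn by (intro mult_mono[OF assms(4,5)]) auto
  also have "\<dots> = c ^ 2 * ((e * l) * (w * k))"
    by (simp add: power2_eq_square algebra_simps)
  also have "\<dots> \<le> c ^ 2 * ((Q * z) * (w * k))"
    using assms by (intro mult_left_mono mult_right_mono) auto
  also have "\<dots> = c ^ 2 * Q * ((z * w) * k)"
    by (simp add: algebra_simps)
  also have "\<dots> \<le> c ^ 2 * Q * ((c * y) * k)"
    using assms by (intro mult_left_mono mult_right_mono) auto
  also have "\<dots> = c ^ 3 * Q * (y * k)"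
    by (simp add: power2_eq_square power3_eq_cube algebra_simps)
  also have "\<dots> \<le> c ^ 3 * Q * (c * x)"
    using assms by (intro mult_left_mono) auto
  also have "\<dots> = c ^ 4 * Q * x"
    by (simp add: power3_eq_cube power4_eq_xxxx algebra_simps)
  finally show ?thesis .
qed

section \<open>Decoupling of events with interlaced coordinates\<close>

context shift_space
begin

lemma mixes_upD:
  assumes "mixes_up P m c" "depends_on J B" "depends_on K C" "finite J" "finite K"
    "\<And>i j. i \<in> J \<Longrightarrow> j \<in> K \<Longrightarrow> i + m < j"
  shows "prob (B \<inter> C) \<le> c * (prob B * prob C)"
  using assms unfolding mixes_up_def by blast

lemma mixes_lowD:
  assumes "mixes_low P m c" "depends_on J B" "depends_on K C" "finite J" "finite K"
    "\<And>i j. i \<in> J \<Longrightarrow> j \<in> K \<Longrightarrow> i + m < j"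
  shows "prob B * prob C \<le> c * prob (B \<inter> C)"
  using assms unfolding mixes_low_def by blast

text \<open>The last window cuts the atom into \<open>L\<close> before and \<open>K\<close> after
  it. Then \<open>K\<close>, and next \<open>W r\<close>, can be split off from the right, each
  lying wholly in the future of what remains; what is left is \<open>E\<close> with
  \<open>L\<close>, interlaced but with one window fewer. Joining \<open>E\<close> with
  \<open>W r\<close> and \<open>L\<close> with \<open>K\<close> again uses mixing in the opposite
  direction, which is why both inequalities are proved together.\<close>

lemma decouple_agree:
  fixes a :: "nat \<Rightarrow> nat"
  assumes mix: "mixes_up P m c" "mixes_low P m c" "c \<ge> 1"
    and W: "\<And>i. i < r \<Longrightarrow> depends_on {a i..<a i + n} (W i)"
    and gap: "\<And>i j. i < j \<Longrightarrow> j < r \<Longrightarrow> a i + n + m \<le> a j"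
    and J: "finite J" "\<And>x i. x \<in> J \<Longrightarrow> i < r \<Longrightarrow> x + m < a i \<or> a i + n + m \<le> x"
  shows "prob ((\<Inter>i<r. W i) \<inter> agree v J) \<le> c ^ (4 * r) * (prob (\<Inter>i<r. W i) * prob (agree v J))
    \<and> prob (\<Inter>i<r. W i) * prob (agree v J) \<le> c ^ (4 * r) * prob ((\<Inter>i<r. W i) \<inter> agree v J)"
  using W gap J
proof (induction r arbitrary: J)
  case 0
  then show ?case using prob_space by simp
next
  case (Suc r)
  define E where "E = (\<Inter>i<r. W i)"
  define D where "D = (\<Union>i<r. {a i..<a i + n})"
  define L where "L = {x\<in>J. x + m < a r}"
  define K where "K = {x\<in>J. a r + n + m \<le> x}"
  have J_eq: "agree v J = agree v L \<inter> agree v K"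
    unfolding agree_Un[symmetric] L_def K_def using Suc.prems(4)[of _ r]
    by (intro arg_cong[where f = "agree v"]) auto
  have finite: "finite D" "finite L" "finite K" "finite {a r..<a r + n}"
    using Suc.prems(3) by (auto simp: D_def L_def K_def)
  have dep: "depends_on D E" "depends_on {a r..<a r + n} (W r)"
      "depends_on L (agree v L)" "depends_on K (agree v K)"
    unfolding E_def D_def using Suc.prems(1)
    by (auto intro!: depends_on_INT depends_on_agree)
  have D_bd: "x + m < a r" if "x \<in> D" for x
    using that Suc.prems(2)[of _ r] unfolding D_def by force
  have IH: "prob (E \<inter> agree v L) \<le> c ^ (4 * r) * (prob E * prob (agree v L))"
     "prob E * prob (agree v L) \<le> c ^ (4 * r) * prob (E \<inter> agree v L)"
    using Suc.IH[of L] Suc.prems unfolding E_def L_def by auto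
  have dep1: "depends_on (D \<union> L) (E \<inter> agree v L)"
    and dep2: "depends_on (D \<union> L \<union> {a r..<a r + n}) (E \<inter> agree v L \<inter> W r)"
    by (intro depends_on_Int dep)+
  have sep1: "x + m < y" if "x \<in> D \<union> L" "y \<in> {a r..<a r + n}" for x y
    using that D_bd by (force simp: L_def)
  have sep2: "x + m < y" if "x \<in> D \<union> L \<union> {a r..<a r + n}" "y \<in> K" for x y
    using that D_bd by (force simp: L_def K_def)
  have sep3: "x + m < y" if "x \<in> L" "y \<in> K" for x y
    using that by (auto simp: L_def K_def)
  have ups:
    "prob (E \<inter> agree v L \<inter> W r \<inter> agree v K) \<le> c * (prob (E \<inter> agree v L \<inter> W r) * prob (agree v K))"
    "prob (E \<inter> agree v L \<inter> W r) \<le> c * (prob (E \<inter> agree v L) * prob (W r))"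
    "prob (E \<inter> W r) \<le> c * (prob E * prob (W r))"
    "prob (agree v L \<inter> agree v K) \<le> c * (prob (agree v L) * prob (agree v K))"
    by (rule mixes_upD[OF mix(1) dep2 dep(4)] mixes_upD[OF mix(1) dep1 dep(2)]
       mixes_upD[OF mix(1) dep(1,2)] mixes_upD[OF mix(1) dep(3,4)];
       use finite D_bd sep1 sep2 sep3 in force)+
  have lows:
    "prob (E \<inter> agree v L \<inter> W r) * prob (agree v K) \<le> c * prob (E \<inter> agree v L \<inter> W r \<inter> agree v K)"
    "prob (E \<inter> agree v L) * prob (W r) \<le> c * prob (E \<inter> agree v L \<inter> W r)"
    "prob E * prob (W r) \<le> c * prob (E \<inter> W r)"
    "prob (agree v L) * prob (agree v K) \<le> c * prob (agree v L \<inter> agree v K)"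
    by (rule mixes_lowD[OF mix(2) dep2 dep(4)] mixes_lowD[OF mix(2) dep1 dep(2)]
       mixes_lowD[OF mix(2) dep(1,2)] mixes_lowD[OF mix(2) dep(3,4)];
       use finite D_bd sep1 sep2 sep3 in force)+
  have eqs: "(\<Inter>i<Suc r. W i) = E \<inter> W r"
    "E \<inter> W r \<inter> (agree v L \<inter> agree v K) = E \<inter> agree v L \<inter> W r \<inter> agree v K"
    unfolding E_def by (auto simp: lessThan_Suc)
  have pw: "c ^ (4 * Suc r) = c ^ 4 * c ^ (4 * r)"
    by (simp add: power_add)
  have nn: "0 \<le> c" "0 \<le> c ^ (4 * r)" using mix(3) by auto
  show ?case
    unfolding J_eq eqs pw
    using decouple_step_up[OF ups(1,2) IH(1) lows(3,4)] decouple_step_low[OF lows(1,2) IH(2) ups(3,4)] nn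
    by simp
qed

text \<open>Both ratio bounds for atoms are summed over a countable partition of \<open>B\<close>;
  integrals over \<open>count_space V\<close> serve as these sums.\<close>

lemma decouple:
  fixes a :: "nat \<Rightarrow> nat"
  assumes mix: "mixes_up P m c" "mixes_low P m c" "c \<ge> 1"
    and W: "\<And>i. i < r \<Longrightarrow> depends_on {a i..<a i + n} (W i)"
    and gap: "\<And>i j. i < j \<Longrightarrow> j < r \<Longrightarrow> a i + n + m \<le> a j"
    and J: "finite J" "\<And>x i. x \<in> J \<Longrightarrow> i < r \<Longrightarrow> x + m < a i \<or> a i + n + m \<le> x"
    and B: "depends_on J B"
  shows "\<bar>prob ((\<Inter>i<r. W i) \<inter> B) - prob (\<Inter>i<r. W i) * prob B\<bar>
     \<le> (c ^ (4 * r) - 1) * (prob (\<Inter>i<r. W i) * prob B)"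
proof -
  define E where "E = (\<Inter>i<r. W i)"
  define Q where "Q = c ^ (4 * r)"
  have Q: "Q \<ge> 1" unfolding Q_def using mix(3) by (rule one_le_power)
  have E: "E \<in> events"
    unfolding E_def using W
    by (intro depends_on_events[where J = "\<Union>i<r. {a i..<a i + n}"] depends_on_INT) auto
  obtain V where V: "countable V" "disjoint_family_on (\<lambda>v. agree v J) V" "B = (\<Union>v\<in>V. agree v J)"
    using depends_on_UN_agree[OF J(1) B] by blast
  have ag: "agree v J \<in> events" for v
    using depends_on_events[OF J(1) depends_on_agree] .
  have emB: "emeasure P B = (\<integral>\<^sup>+v. emeasure P (agree v J) \<partial>count_space V)"
    unfolding V(3) using V ag by (intro emeasure_UN_countable) auto
  have EB: "E \<inter> B = (\<Union>v\<in>V. E \<inter> agree v J)" unfolding V(3) by auto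
  have emEB: "emeasure P (E \<inter> B) = (\<integral>\<^sup>+v. emeasure P (E \<inter> agree v J) \<partial>count_space V)"
    unfolding EB using V ag E
    by (intro emeasure_UN_countable) (auto simp: disjoint_family_on_def)
  have step: "prob (E \<inter> agree v J) \<le> Q * (prob E * prob (agree v J))
    \<and> prob E * prob (agree v J) \<le> Q * prob (E \<inter> agree v J)" for v
    unfolding E_def Q_def by (rule decouple_agree[OF mix W gap J])
  have "emeasure P (E \<inter> B) \<le> (\<integral>\<^sup>+v. ennreal (Q * prob E) * emeasure P (agree v J) \<partial>count_space V)"
    unfolding emEB using step Q
    by (intro nn_integral_mono) (simp add: emeasure_eq_measure ennreal_mult[symmetric] mult.assoc)
  also have "\<dots> = ennreal (Q * prob E) * emeasure P B"
    unfolding emB by (rule nn_integral_cmult) simp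
  finally have 1: "prob (E \<inter> B) \<le> Q * (prob E * prob B)"
    using Q by (simp add: emeasure_eq_measure ennreal_mult[symmetric] mult.assoc)
  have "ennreal (prob E) * emeasure P B = (\<integral>\<^sup>+v. ennreal (prob E) * emeasure P (agree v J) \<partial>count_space V)"
    unfolding emB by (rule nn_integral_cmult[symmetric]) simp
  also have "\<dots> \<le> (\<integral>\<^sup>+v. ennreal Q * emeasure P (E \<inter> agree v J) \<partial>count_space V)"
    using step Q
    by (intro nn_integral_mono) (simp add: emeasure_eq_measure ennreal_mult[symmetric])
  also have "\<dots> = ennreal Q * emeasure P (E \<inter> B)"
    unfolding emEB by (rule nn_integral_cmult) simp
  finally have 2: "prob E * prob B \<le> Q * prob (E \<inter> B)"
    using Q by (simp add: emeasure_eq_measure ennreal_mult[symmetric])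
  \<comment> \<open>The lower ratio \<open>1 / Q\<close> is replaced by the smaller
    \<open>2 - Q\<close>, so that the deviation is \<open>Q - 1\<close> on both sides; this rests on
    \<open>(2 - Q) * Q = 1 - (Q - 1)\<^sup>2 \<le> 1\<close>.\<close>
  have "(2 - Q) * (prob E * prob B) \<le> prob (E \<inter> B)"
  proof (cases "Q \<le> 2")
    case True
    have "(2 - Q) * (prob E * prob B) \<le> (2 - Q) * (Q * prob (E \<inter> B))"
      using 2 True by (intro mult_left_mono) auto
    also have "\<dots> = (1 - (Q - 1)\<^sup>2) * prob (E \<inter> B)"
      by (simp add: power2_eq_square algebra_simps)
    also have "\<dots> \<le> 1 * prob (E \<inter> B)"
      by (intro mult_right_mono) auto
    finally show ?thesis by simp
  next
    case False
    then have "(2 - Q) * (prob E * prob B) \<le> 0"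
      by (intro mult_nonpos_nonneg) auto
    then show ?thesis using measure_nonneg[of P "E \<inter> B"] by linarith
  qed
  then show ?thesis
    unfolding E_def[symmetric] Q_def[symmetric] using 1 by (simp add: algebra_simps abs_le_iff)
qed

text \<open>These windows follow one another without anything interlaced, so each new one costs a
  single factor \<open>c\<close>.\<close>

lemma windows_prob:
  fixes a :: "nat \<Rightarrow> nat"
  assumes mix: "mixes_up P m c" "mixes_low P m c" "c \<ge> 1"
    and W: "\<And>i. i < r \<Longrightarrow> depends_on {a i..<a i + n} (W i)" "\<And>i. i < r \<Longrightarrow> prob (W i) = p"
    and gap: "\<And>i j. i < j \<Longrightarrow> j < r \<Longrightarrow> a i + n + m \<le> a j"
  shows "prob (\<Inter>i<r. W i) \<le> c ^ r * p ^ r \<and> p ^ r \<le> c ^ r * prob (\<Inter>i<r. W i)"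
  using W gap
proof (induction r)
  case 0
  then show ?case using prob_space by simp
next
  case (Suc r)
  have dep: "depends_on (\<Union>i<r. {a i..<a i + n}) (\<Inter>i<r. W i)" "depends_on {a r..<a r + n} (W r)"
    using Suc.prems(1) by (auto intro!: depends_on_INT)
  have sep: "x + m < y" if "x \<in> (\<Union>i<r. {a i..<a i + n})" "y \<in> {a r..<a r + n}" for x y
    using that Suc.prems(3)[of _ r] by force
  have eq: "(\<Inter>i<Suc r. W i) = (\<Inter>i<r. W i) \<inter> W r" by (auto simp: lessThan_Suc)
  have p: "prob (W r) = p" "p \<ge> 0" using Suc.prems(2)[of r] by (auto simp flip: Suc.prems(2)[of r])
  have IH: "prob (\<Inter>i<r. W i) \<le> c ^ r * p ^ r" "p ^ r \<le> c ^ r * prob (\<Inter>i<r. W i)"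
    using Suc.IH Suc.prems by auto
  have "prob ((\<Inter>i<r. W i) \<inter> W r) \<le> c * (prob (\<Inter>i<r. W i) * p)"
    using mixes_upD[OF mix(1) dep _ _ sep] p by auto
  also have "\<dots> \<le> c * ((c ^ r * p ^ r) * p)"
    using IH(1) p mix(3) by (intro mult_left_mono mult_right_mono) auto
  finally have 1: "prob ((\<Inter>i<r. W i) \<inter> W r) \<le> c ^ Suc r * p ^ Suc r"
    by (simp add: algebra_simps)
  have "p ^ Suc r \<le> (c ^ r * prob (\<Inter>i<r. W i)) * p"
    using mult_right_mono[OF IH(2) p(2)] by (simp add: algebra_simps)
  also have "\<dots> = c ^ r * (prob (\<Inter>i<r. W i) * p)" by simp
  also have "\<dots> \<le> c ^ r * (c * prob ((\<Inter>i<r. W i) \<inter> W r))"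
    using mixes_lowD[OF mix(2) dep _ _ sep] p mix(3) by (intro mult_left_mono) auto
  finally have "p ^ Suc r \<le> c ^ Suc r * prob ((\<Inter>i<r. W i) \<inter> W r)"
    by (simp add: algebra_simps)
  then show ?case using 1 unfolding eq by simp
qed

end

section \<open>Exponential decay of cylinders\<close>

lemma cyl_of_eq_agree: "cyl_of \<omega> n = agree \<omega> {..<n}"
  unfolding cyl_of_def cylinder_def agree_def by auto

context shift_space
begin

lemma prob_shift_eq: "finite J \<Longrightarrow> depends_on J B \<Longrightarrow> prob ((left_shift ^^ k) -` B) = prob B"
  using prob_shift[OF depends_on_events] by blast

text \<open>Two letters of positive probability keep every letter below some
  \<open>\<rho> < 1\<close>. Sampling a block at spacing \<open>M = Suc m\<close> leaves
  \<open>m\<close> coordinates between sampled sites, so each of them contributes a factor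
  \<open>c * \<rho>\<close>, which is below 1 for \<open>c\<close> close to 1.\<close>

lemma exponential_decay:
  assumes "psi_mixing P" "\<exists>a b :: 'a. a \<noteq> b" "\<And>a. prob (cylinder [a]) > 0"
  obtains C \<theta> where "C > 0" "0 < \<theta>" "\<theta> < 1" "\<And>v a n. prob (agree v {a..<a + n}) \<le> C * \<theta> ^ n"
proof -
  obtain x y :: 'a where xy: "x \<noteq> y" using assms(2) by blast
  have cyl_events: "cylinder [z] \<in> events" for z :: 'a
    using depends_on_events[OF _ depends_on_cylinder] by blast
  have sum_le: "prob (cylinder [z]) \<le> 1 - prob (cylinder [w])" if "z \<noteq> w" for z w :: 'a
  proof -
    have "prob (cylinder [z]) + prob (cylinder [w]) = prob (cylinder [z] \<union> cylinder [w])"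
      using that cyl_events by (intro finite_measure_Union[symmetric]) (auto simp: cylinder_def)
    also have "\<dots> \<le> 1" by simp
    finally show ?thesis by simp
  qed
  \<comment> \<open>Two letters suffice even for an infinite alphabet: any letter differs from
    \<open>x\<close> or from \<open>y\<close>, so its cylinder is disjoint from one of
    theirs.\<close>
  define \<rho> where "\<rho> = max (1/2) (max (1 - prob (cylinder [x])) (1 - prob (cylinder [y])))"
  have \<rho>: "0 < \<rho>" "\<rho> < 1" unfolding \<rho>_def using assms(3)[of x] assms(3)[of y] by auto
  have letter: "prob (cylinder [z]) \<le> \<rho>" for z
    using sum_le[of z x] sum_le[of z y] xy unfolding \<rho>_def by (cases "z = x") auto
  have site: "prob (agree v {i}) \<le> \<rho>" for v :: "nat \<Rightarrow> 'a" and i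
  proof -
    have "agree v {i} = (left_shift ^^ i) -` cylinder [v i]"
      unfolding agree_def cylinder_def left_shift_funpow by auto
    then show ?thesis using prob_shift[OF cyl_events, of i "v i"] letter[of "v i"] by simp
  qed
  \<comment> \<open>Any \<open>c\<close> strictly between 1 and \<open>1 / \<rho>\<close> would do;
    this one gives \<open>c * \<rho> = 2 * \<rho> / (1 + \<rho>) < 1\<close>.\<close>
  define c where "c = 2 / (1 + \<rho>)"
  have c: "c > 1" using \<rho> unfolding c_def by simp
  define q where "q = c * \<rho>"
  have q: "0 < q" "q < 1" using \<rho> unfolding q_def c_def by (auto simp: field_simps)
  obtain m where m: "mixes_up P m c"
    using psi_mixing_close[OF assms(1) c] by blast
  define M where "M = Suc m"
  have progression: "prob (agree v ((\<lambda>i. a + i * M) ` {..<s})) \<le> q ^ s" for v :: "nat \<Rightarrow> 'a" and a s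
  proof (induction s)
    case (Suc s)
    have "agree v ((\<lambda>i. a + i * M) ` {..<Suc s})
        = agree v ((\<lambda>i. a + i * M) ` {..<s}) \<inter> agree v {a + s * M}"
      unfolding agree_Un[symmetric] by (simp add: lessThan_Suc)
    also have "prob \<dots> \<le> c * (prob (agree v ((\<lambda>i. a + i * M) ` {..<s})) * prob (agree v {a + s * M}))"
    proof (rule mixes_upD[OF m depends_on_agree depends_on_agree])
      fix i j assume "i \<in> (\<lambda>i. a + i * M) ` {..<s}" "j \<in> {a + s * M}"
      then obtain i' where i': "i = a + i' * M" "i' < s" "j = a + s * M" by blast
      have "Suc i' * M \<le> s * M" using i'(2) by (intro mult_right_mono) auto
      then show "i + m < j" using i' unfolding M_def by simp
    qed auto
    also have "\<dots> \<le> c * (q ^ s * \<rho>)"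
      using Suc.IH site c q by (intro mult_left_mono mult_mono) auto
    finally show ?case unfolding q_def by (simp add: mult_ac)
  qed (use prob_le_1 in auto)
  define \<theta> where "\<theta> = root M q"
  have M: "M > 0" unfolding M_def by simp
  have \<theta>: "0 < \<theta>" "\<theta> < 1" "\<theta> ^ M = q"
    unfolding \<theta>_def using q M by (auto simp: real_root_lt_1_iff)
  have decay: "prob (agree v {a..<a + n}) \<le> 1 / q * \<theta> ^ n" for v :: "nat \<Rightarrow> 'a" and a n
  proof -
    let ?s = "n div M"
    have sub: "(\<lambda>i. a + i * M) ` {..<?s} \<subseteq> {a..<a + n}"
    proof (safe)
      fix i assume "i < ?s"
      then have "Suc i * M \<le> ?s * M" by (intro mult_right_mono) auto
      also have "\<dots> \<le> n" by simp
      finally show "a + i * M \<in> {a..<a + n}" using M by simp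
    qed
    have "prob (agree v {a..<a + n}) \<le> prob (agree v ((\<lambda>i. a + i * M) ` {..<?s}))"
      using sub by (intro finite_measure_mono depends_on_events[OF _ depends_on_agree])
        (auto simp: agree_def)
    also have "\<dots> \<le> q ^ ?s" by (rule progression)
    \<comment> \<open>The factor \<open>1 / q\<close> pays for the incomplete last block:
      \<open>n\<close> is at most \<open>M * (?s + 1)\<close>.\<close>
    also have "\<dots> = 1 / q * \<theta> ^ (M * (?s + 1))"
      using q by (simp only: power_mult \<theta>(3)) simp
    also have "\<dots> \<le> 1 / q * \<theta> ^ n"
    proof -
      have "n \<le> M * (?s + 1)"
        using M by (metis add.commute div_mult_mod_eq distrib_left less_imp_le mod_less_divisor
            mult.commute mult.right_neutral nat_add_left_cancel_le)
      then show ?thesis using q \<theta> by (intro mult_left_mono power_decreasing) auto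
    qed
    finally show ?thesis .
  qed
  show ?thesis using that[OF _ \<theta>(1,2) decay] q by auto
qed

end

section \<open>Hitting events, their coordinates and neighbouring indices\<close>

definition hit_set :: "nat \<Rightarrow> (nat \<Rightarrow> nat) \<Rightarrow> (nat \<Rightarrow> 'a) set \<Rightarrow> nat \<Rightarrow> (nat \<Rightarrow> 'a) set" where
  "hit_set l d A k = (\<Inter>i<l. (left_shift ^^ (d (Suc i) * k)) -` A)"

definition hit_coords :: "nat \<Rightarrow> (nat \<Rightarrow> nat) \<Rightarrow> nat \<Rightarrow> nat \<Rightarrow> nat set" where
  "hit_coords l d n k = (\<Union>i<l. {d (Suc i) * k..<d (Suc i) * k + n})"

text \<open>\<open>g\<close> will be \<open>n + m\<close>: two windows of length \<open>n\<close>
  leave \<open>m\<close> coordinates free between them exactly when their starts differ by at least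
  \<open>n + m\<close>. The pair of strict inequalities expresses a distance below \<open>g\<close>
  without truncated subtraction.\<close>

definition neighbours :: "nat \<Rightarrow> (nat \<Rightarrow> nat) \<Rightarrow> nat \<Rightarrow> nat \<Rightarrow> nat \<Rightarrow> nat set" where
  "neighbours l d g N k = {j\<in>{1..N}. \<exists>i<l. \<exists>i'<l.
     d (Suc i) * k < d (Suc i') * j + g \<and> d (Suc i') * j < d (Suc i) * k + g}"

lemma hit_setD: "x \<in> hit_set l d A k \<Longrightarrow> i < l \<Longrightarrow> (left_shift ^^ (d (Suc i) * k)) x \<in> A"
  unfolding hit_set_def by simp

lemma depends_on_window: "depends_on {k..<k + n} ((left_shift ^^ k) -` cyl_of \<omega> n)"
proof -
  have "(\<lambda>i. i + k) ` {..<n} = {k..<k + n}"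
    using image_add_atLeastLessThan'[of k 0 n] by (simp add: lessThan_atLeast0 add.commute)
  then show ?thesis
    using depends_on_shift[OF depends_on_agree[of "{..<n}" \<omega>], of k] unfolding cyl_of_eq_agree by simp
qed

lemma depends_on_hit_set: "depends_on (hit_coords l d n k) (hit_set l d (cyl_of \<omega> n) k)"
  unfolding hit_set_def hit_coords_def by (intro depends_on_INT depends_on_window)

lemma finite_hit_coords: "finite (hit_coords l d n k)"
  unfolding hit_coords_def by simp

lemma finite_neighbours: "finite (neighbours l d g N k)"
  unfolding neighbours_def by simp

text \<open>For a fixed pair of windows the start \<open>d (Suc i') * j\<close> determines
  \<open>j\<close> and lies within \<open>g\<close> of a given point. What matters is that the bound
  is linear in \<open>g\<close> and does not involve \<open>k\<close> or \<open>N\<close>.\<close>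

lemma card_neighbours:
  assumes "\<And>i. i < l \<Longrightarrow> d (Suc i) \<ge> 1"
  shows "card (neighbours l d g N k) \<le> l * (l * (2 * g))"
proof -
  let ?S = "\<lambda>i i'. {j. d (Suc i) * k < d (Suc i') * j + g \<and> d (Suc i') * j < d (Suc i) * k + g}"
  have S: "finite (?S i i') \<and> card (?S i i') \<le> 2 * g" if "i' < l" for i i'
  proof -
    have inj: "inj_on (\<lambda>j. d (Suc i') * j + g) (?S i i')"
      using assms[OF that] by (auto simp: inj_on_def)
    have im: "(\<lambda>j. d (Suc i') * j + g) ` ?S i i' \<subseteq> {d (Suc i) * k<..<d (Suc i) * k + 2 * g}"
      by auto
    have "finite (?S i i')"
      using inj finite_subset[OF im] finite_imageD by blast
    moreover have "card (?S i i') \<le> card {d (Suc i) * k<..<d (Suc i) * k + 2 * g}"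
      using card_inj_on_le[OF inj im] by simp
    ultimately show ?thesis by simp
  qed
  have "neighbours l d g N k \<subseteq> (\<Union>i<l. \<Union>i'<l. ?S i i')"
    unfolding neighbours_def by auto
  then have "card (neighbours l d g N k) \<le> card (\<Union>i<l. \<Union>i'<l. ?S i i')"
    using S by (intro card_mono) auto
  also have "\<dots> \<le> (\<Sum>i<l. card (\<Union>i'<l. ?S i i'))"
    by (rule card_UN_le) simp
  also have "\<dots> \<le> (\<Sum>i<l. \<Sum>i'<l. card (?S i i'))"
    by (intro sum_mono card_UN_le) simp
  also have "\<dots> \<le> (\<Sum>i<l. \<Sum>i'<l. 2 * g)"
    using S by (intro sum_mono) auto
  finally show ?thesis by simp
qed

lemma neighbours_subset: "neighbours l d g N k \<subseteq> {1..N}"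
  unfolding neighbours_def by blast

lemma neighbours_sym:
  "k \<in> {1..N} \<Longrightarrow> j \<in> neighbours l d g N k \<Longrightarrow> k \<in> neighbours l d g N j"
  unfolding neighbours_def by auto

lemma neighbours_self:
  "k \<in> {1..N} \<Longrightarrow> l \<ge> 1 \<Longrightarrow> g \<ge> 1 \<Longrightarrow> k \<in> neighbours l d g N k"
  unfolding neighbours_def by (auto intro!: exI[of _ 0])

lemma hit_coords_far:
  assumes "j \<in> {1..N} - neighbours l d (n + m) N k" "x \<in> hit_coords l d n j" "i < l"
  shows "x + m < d (Suc i) * k \<or> d (Suc i) * k + n + m \<le> x"
proof -
  obtain i' where "i' < l" "d (Suc i') * j \<le> x" "x < d (Suc i') * j + n"
    using assms(2) unfolding hit_coords_def by auto
  moreover from this have "\<not> (d (Suc i) * k < d (Suc i') * j + (n + m) \<and> d (Suc i') * j < d (Suc i) * k + (n + m))"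
    using assms(1,3) unfolding neighbours_def by blast
  ultimately show ?thesis by linarith
qed

lemma S_hit_eq_hits: "S_hit l d A N x = real (hits (hit_set l d A) {1..N} x)"
proof -
  have "X_hit l d A k x = indicator (hit_set l d A k) x" for k
  proof -
    \<comment> \<open>The factors are numbered from 1, the intersections from 0 to suit induction
      over \<open>i < r\<close>.\<close>
    have "X_hit l d A k x = (\<Prod>i<l. indicator A ((left_shift ^^ (d (Suc i) * k)) x))"
      unfolding X_hit_def by (rule prod.reindex_bij_witness[of _ Suc "\<lambda>i. i - 1"]) auto
    also have "\<dots> = (if \<forall>i<l. (left_shift ^^ (d (Suc i) * k)) x \<in> A then 1 else 0)"
      by (auto simp: indicator_def intro!: prod.neutral prod_zero)
    finally show ?thesis
      unfolding hit_set_def by (auto simp: indicator_def)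
  qed
  then show ?thesis
    unfolding S_hit_def by (simp add: hits_eq_sum real_of_nat_indicator)
qed

section \<open>Hitting events and their correlations\<close>

lemma (in prob_space) sum_prob_level_le:
  fixes h :: "'a \<Rightarrow> nat"
  assumes "\<And>w. {x\<in>space M. h x = w} \<in> events" "A \<in> events"
  shows "(\<Sum>w\<le>W. prob (A \<inter> {x\<in>space M. h x = w})) \<le> prob A"
proof -
  have "(\<Sum>w\<le>W. prob (A \<inter> {x\<in>space M. h x = w})) = prob (\<Union>w\<le>W. A \<inter> {x\<in>space M. h x = w})"
    using assms by (intro finite_measure_finite_Union[symmetric]) (auto simp: disjoint_family_on_def)
  also have "\<dots> \<le> prob A"
    using assms by (intro finite_measure_mono) auto
  finally show ?thesis .
qed

lemma sum_geometric_tail_le: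
  fixes \<theta> :: real
  assumes "0 < \<theta>" "\<theta> < 1" "finite F" "\<And>r. r \<in> F \<Longrightarrow> R \<le> r"
  shows "(\<Sum>r\<in>F. \<theta> ^ r) \<le> \<theta> ^ R / (1 - \<theta>)"
proof -
  have "(\<Sum>r\<in>F. \<theta> ^ r) = (\<Sum>s\<in>(\<lambda>r. r - R) ` F. \<theta> ^ (s + R))"
    using assms(4) by (subst sum.reindex) (auto simp: inj_on_def eq_diff_iff)
  also have "\<dots> = \<theta> ^ R * (\<Sum>s\<in>(\<lambda>r. r - R) ` F. \<theta> ^ s)"
    by (simp add: power_add sum_distrib_left mult.commute)
  also have "(\<Sum>s\<in>(\<lambda>r. r - R) ` F. \<theta> ^ s) \<le> (\<Sum>s. \<theta> ^ s)"
    using assms by (intro sum_le_suminf summable_geometric) auto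
  also have "(\<Sum>s. \<theta> ^ s) = 1 / (1 - \<theta>)"
    using assms by (intro suminf_geometric) auto
  finally show ?thesis using assms by (simp add: mult_left_mono)
qed

locale hit_sums = shift_space +
  fixes l :: nat and d :: "nat \<Rightarrow> nat" and \<omega> :: "nat \<Rightarrow> 'a"
  assumes l: "l \<ge> 1" and d_pos: "d 1 \<ge> 1" and d_mono: "strict_mono_on {1..l} d"
begin

abbreviation "A n \<equiv> cyl_of \<omega> n"
abbreviation "E n \<equiv> hit_set l d (cyl_of \<omega> n)"
abbreviation "p n \<equiv> prob (cyl_of \<omega> n)"

lemma d_less: "i < j \<Longrightarrow> j < l \<Longrightarrow> d (Suc i) < d (Suc j)"
  using d_mono by (auto simp: strict_mono_on_def)

lemma d_le: "i \<le> j \<Longrightarrow> j < l \<Longrightarrow> d (Suc i) \<le> d (Suc j)"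
  using d_less[of i j] by (cases "i = j") auto

lemma d_ge_1: "i < l \<Longrightarrow> d (Suc i) \<ge> 1"
  using d_le[of 0 i] d_pos by simp

lemma d_l_ge_1: "d l \<ge> 1"
  using d_ge_1[of "l - 1"] l by simp

lemma d_gap:
  assumes "i < j" "j < l" "g \<le> k"
  shows "d (Suc i) * k + g \<le> d (Suc j) * k"
proof -
  have "Suc (d (Suc i)) * k \<le> d (Suc j) * k"
    using d_less[OF assms(1,2)] by (intro mult_right_mono) auto
  then show ?thesis using assms(3) by simp
qed

lemma UNIV_events: "UNIV \<in> events"
  using sets.top[of P] by simp

lemma E_events: "E n k \<in> events"
  by (rule depends_on_events[OF finite_hit_coords depends_on_hit_set])

lemma A_events: "A n \<in> events"
  unfolding cyl_of_eq_agree by (intro depends_on_events[OF _ depends_on_agree]) auto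

lemma prob_window: "prob ((left_shift ^^ k) -` A n) = p n"
  using prob_shift[OF A_events] by blast

lemma prob_E_le: "prob (E n k) \<le> p n"
proof -
  have "E n k \<subseteq> (left_shift ^^ (d 1 * k)) -` A n"
    using l unfolding hit_set_def by auto
  then have "prob (E n k) \<le> prob ((left_shift ^^ (d 1 * k)) -` A n)"
    using prob_shift[OF A_events] by (intro finite_measure_mono) auto
  then show ?thesis by (simp add: prob_window)
qed

text \<open>Distinct multipliers put consecutive windows at least \<open>k\<close> apart, so
  \<open>k \<ge> n + m\<close> leaves the gap \<open>m\<close> between them.\<close>

lemma prob_E_bounds:
  assumes "mixes_up P m c" "mixes_low P m c" "c \<ge> 1" "k \<ge> n + m"
  shows "prob (E n k) \<le> c ^ l * p n ^ l" "p n ^ l \<le> c ^ l * prob (E n k)"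
  using windows_prob[OF assms(1-3), where a = "\<lambda>i. d (Suc i) * k" and n = n and r = l and p = "p n"
      and W = "\<lambda>i. (left_shift ^^ (d (Suc i) * k)) -` A n"]
    depends_on_window prob_window d_gap[of _ _ "n + m" k] assms(4)
  unfolding hit_set_def by (auto simp: add.assoc)

text \<open>The error for each level set is proportional to its own probability, and these sum to at
  most 1; hence the number of levels does not enter. The exponent is four uses of mixing for each of
  the \<open>l\<close> windows.\<close>

lemma decoupled_count:
  fixes N :: nat
  assumes "mixes_up P m c" "mixes_low P m c" "c \<ge> 1" "k \<ge> n + m"
  defines "J \<equiv> {1..N} - neighbours l d (n + m) N k"
  shows "(\<Sum>w\<le>W. \<bar>prob (E n k \<inter> {x\<in>space P. hits (E n) J x = w})
             - prob (E n k) * prob {x\<in>space P. hits (E n) J x = w}\<bar>) \<le> (c ^ (4 * l) - 1) * prob (E n k)"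
proof -
  let ?L = "\<lambda>w. {x\<in>space P. hits (E n) J x = w}"
  have L_events: "?L w \<in> events" for w
    using E_events by (intro hits_level_sets) (auto simp: J_def)
  have dep: "depends_on (\<Union>j\<in>J. hit_coords l d n j) (?L w)" for w
  proof (rule depends_onI)
    fix x y assume *: "\<And>i. i \<in> (\<Union>j\<in>J. hit_coords l d n j) \<Longrightarrow> x i = y i" "x \<in> ?L w"
    have "x \<in> E n j \<longleftrightarrow> y \<in> E n j" if "j \<in> J" for j
      using that *(1) by (intro depends_onD[OF depends_on_hit_set]) auto
    then have "hits (E n) J x = hits (E n) J y"
      unfolding hits_def by (intro arg_cong[where f = card]) auto
    then show "y \<in> ?L w" using *(2) by simp
  qed
  have "\<bar>prob (E n k \<inter> ?L w) - prob (E n k) * prob (?L w)\<bar> \<le> (c ^ (4 * l) - 1) * (prob (E n k) * prob (?L w))" for w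
    unfolding hit_set_def[of l d "A n" k]
  proof (rule decouple[OF assms(1-3) _ _ _ _ dep[of w]])
    show "depends_on {d (Suc i) * k..<d (Suc i) * k + n} ((left_shift ^^ (d (Suc i) * k)) -` A n)" for i
      by (rule depends_on_window)
    show "d (Suc i) * k + n + m \<le> d (Suc j) * k" if "i < j" "j < l" for i j
      using d_gap[OF that assms(4)] by simp
    show "x + m < d (Suc i) * k \<or> d (Suc i) * k + n + m \<le> x"
      if "x \<in> (\<Union>j\<in>J. hit_coords l d n j)" "i < l" for x i
      using that hit_coords_far unfolding J_def by blast
  qed (auto simp: J_def finite_hit_coords)
  then have "(\<Sum>w\<le>W. \<bar>prob (E n k \<inter> ?L w) - prob (E n k) * prob (?L w)\<bar>)
     \<le> (\<Sum>w\<le>W. (c ^ (4 * l) - 1) * (prob (E n k) * prob (?L w)))"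
    by (intro sum_mono) auto
  also have "\<dots> = ((c ^ (4 * l) - 1) * prob (E n k)) * (\<Sum>w\<le>W. prob (?L w))"
    by (simp add: sum_distrib_left mult.assoc)
  also have "\<dots> \<le> ((c ^ (4 * l) - 1) * prob (E n k)) * 1"
  proof (rule mult_left_mono)
    show "(\<Sum>w\<le>W. prob (?L w)) \<le> 1"
      using sum_prob_level_le[of "hits (E n) J" UNIV W] L_events UNIV_events prob_space by simp
    show "0 \<le> (c ^ (4 * l) - 1) * prob (E n k)"
      using assms(3) by (intro mult_nonneg_nonneg) auto
  qed
  finally show ?thesis by simp
qed

text \<open>For small \<open>k\<close> mixing gives nothing, but each of the two laws being compared
  has total mass at most \<open>prob (E n k)\<close>.\<close>

lemma crude_count:
  assumes "finite J"
  shows "(\<Sum>w\<le>W. \<bar>prob (E n k \<inter> {x\<in>space P. hits (E n) J x = w})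
             - prob (E n k) * prob {x\<in>space P. hits (E n) J x = w}\<bar>) \<le> 2 * prob (E n k)"
proof -
  let ?L = "\<lambda>w. {x\<in>space P. hits (E n) J x = w}"
  have L_events: "?L w \<in> events" for w
    using E_events assms by (intro hits_level_sets) auto
  have "(\<Sum>w\<le>W. \<bar>prob (E n k \<inter> ?L w) - prob (E n k) * prob (?L w)\<bar>)
     \<le> (\<Sum>w\<le>W. prob (E n k \<inter> ?L w) + prob (E n k) * prob (?L w))"
    by (intro sum_mono) (smt (verit) measure_nonneg mult_nonneg_nonneg)
  also have "\<dots> = (\<Sum>w\<le>W. prob (E n k \<inter> ?L w)) + prob (E n k) * (\<Sum>w\<le>W. prob (?L w))"
    by (simp add: sum.distrib sum_distrib_left)
  also have "\<dots> \<le> prob (E n k) + prob (E n k) * 1"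
    using sum_prob_level_le[of "hits (E n) J" UNIV W] sum_prob_level_le[of "hits (E n) J" "E n k" W]
      L_events UNIV_events prob_space E_events
    by (intro add_mono mult_left_mono) auto
  finally show ?thesis by simp
qed

text \<open>Whatever the other factors do, the last window of the later index starts a distance
  \<open>d l * (j - k)\<close> behind everything the earlier event depends on.\<close>

lemma pair_bound:
  assumes K: "mixes_up P 0 K" and "k < j"
  shows "prob (E n k \<inter> E n j) \<le> K * (prob (E n k) * prob (agree \<omega> {n - d l * (j - k)..<n}))"
proof -
  let ?r = "d l * (j - k)"
  \<comment> \<open>Only the last \<open>?r\<close> symbols of the final window of
    \<open>E n j\<close> lie beyond the final window of \<open>E n k\<close>; truncated subtraction
    makes this the whole window once \<open>?r \<ge> n\<close>.\<close>
  let ?H = "{n - ?r..<n}"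
  let ?D = "(left_shift ^^ (d l * j)) -` agree \<omega> ?H"
  have dj: "d l * j = d l * k + ?r"
    using assms(2) by (metis add_mult_distrib2 le_add_diff_inverse less_imp_le)
  have depD: "depends_on ((\<lambda>i. i + d l * j) ` ?H) ?D"
    by (intro depends_on_shift depends_on_agree)
  have sub: "E n j \<subseteq> ?D"
  proof
    fix x assume "x \<in> E n j"
    then have "(left_shift ^^ (d (Suc (l - 1)) * j)) x \<in> A n"
      using l by (intro hit_setD) auto
    then show "x \<in> ?D"
      using l unfolding cyl_of_eq_agree agree_def by auto
  qed
  have "prob (E n k \<inter> E n j) \<le> prob (E n k \<inter> ?D)"
    using sub E_events depends_on_events[OF _ depD] by (intro finite_measure_mono) auto
  also have "\<dots> \<le> K * (prob (E n k) * prob ?D)"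
  proof (rule mixes_upD[OF K depends_on_hit_set depD finite_hit_coords])
    fix x y assume x: "x \<in> hit_coords l d n k" and y: "y \<in> (\<lambda>i. i + d l * j) ` ?H"
    obtain i where i: "i < l" "x < d (Suc i) * k + n"
      using x unfolding hit_coords_def by auto
    have "d (Suc i) * k \<le> d l * k"
      using d_le[of i "l - 1"] i(1) by (intro mult_right_mono) auto
    moreover have "d l * k + n \<le> y"
      using y dj by auto
    ultimately show "x + 0 < y" using i(2) by linarith
  qed simp
  also have "prob ?D = prob (agree \<omega> ?H)"
    by (rule prob_shift_eq[OF _ depends_on_agree]) simp
  finally show ?thesis .
qed

text \<open>The final windows alone decide: a point in both events, shifted by
  \<open>d l * k\<close>, would return to \<open>A n\<close> after \<open>d l * (j - k)\<close>
  steps.\<close>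

lemma pair_zero:
  assumes "k < j" "A n \<inter> (left_shift ^^ (d l * (j - k))) -` A n = {}"
  shows "E n k \<inter> E n j = {}"
proof -
  let ?r = "d l * (j - k)"
  have dj: "d l * j = ?r + d l * k"
    using assms(1) by (metis add.commute add_mult_distrib2 le_add_diff_inverse less_imp_le)
  have "False" if "x \<in> E n k" "x \<in> E n j" for x
  proof -
    have "(left_shift ^^ (d l * k)) x \<in> A n" "(left_shift ^^ (d l * j)) x \<in> A n"
      using that[THEN hit_setD, of "l - 1"] l by auto
    moreover have "(left_shift ^^ (d l * j)) x = (left_shift ^^ ?r) ((left_shift ^^ (d l * k)) x)"
      unfolding dj funpow_add by simp
    ultimately show False using assms(2) by auto
  qed
  then show ?thesis by auto
qed

text \<open>Three ranges of the distance: below \<open>R\<close> the pair is impossible; up to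
  \<open>n\<close> only the fresh end of the window counts and decays exponentially; beyond
  \<open>n\<close> the whole window is fresh and gives \<open>p n\<close>.\<close>

lemma pair_bound_decay:
  assumes K: "mixes_up P 0 K" "K \<ge> 1" and "k < j"
    and decay: "\<And>v a n. prob (agree v {a..<a + n}) \<le> C * \<theta> ^ n" "C > 0" "0 < \<theta>"
    and R: "\<And>r. 1 \<le> r \<Longrightarrow> r < R \<Longrightarrow> A n \<inter> (left_shift ^^ r) -` A n = {}"
  shows "prob (E n k \<inter> E n j)
    \<le> K * prob (E n k) * (p n + (if d l * (j - k) < R then 0 else C * \<theta> ^ (d l * (j - k))))"
proof -
  let ?r = "d l * (j - k)"
  have r1: "1 \<le> ?r" using d_l_ge_1 assms(3) by simp
  have C0: "0 \<le> C * \<theta> ^ ?r" using decay by simp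
  show ?thesis
  proof (cases "?r < R")
    case True
    then have "prob (E n k \<inter> E n j) = 0"
      using pair_zero[OF assms(3) R[OF r1 True]] by simp
    then show ?thesis using K(2) True by simp
  next
    case False
    have "prob (agree \<omega> {n - ?r..<n}) \<le> p n + C * \<theta> ^ ?r"
    proof (cases "?r \<le> n")
      case True
      then have "prob (agree \<omega> {n - ?r..<n}) \<le> C * \<theta> ^ ?r"
        using decay(1)[of \<omega> "n - ?r" ?r] by simp
      then show ?thesis by (rule order_trans) simp
    next
      case False
      then show ?thesis using C0 by (simp add: cyl_of_eq_agree lessThan_atLeast0)
    qed
    then have "K * (prob (E n k) * prob (agree \<omega> {n - ?r..<n})) \<le> K * (prob (E n k) * (p n + C * \<theta> ^ ?r))"
      using K(2) by (intro mult_left_mono) auto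
    then show ?thesis
      using pair_bound[OF K(1) assms(3), of n] False by (simp add: mult.assoc)
  qed
qed

text \<open>It suffices to sum over later neighbours. There \<open>p n\<close> is paid at most
  \<open>Q\<close> times, while different \<open>j\<close> have different distances, so the
  exponential terms form part of a geometric series starting at \<open>R\<close> and do not see the
  number of neighbours.\<close>

lemma clump_bound:
  assumes K: "mixes_up P 0 K" "K \<ge> 1"
    and decay: "\<And>v a n. prob (agree v {a..<a + n}) \<le> C * \<theta> ^ n" "C > 0" "0 < \<theta>" "\<theta> < 1"
    and R: "\<And>r. 1 \<le> r \<Longrightarrow> r < R \<Longrightarrow> A n \<inter> (left_shift ^^ r) -` A n = {}"
    and Q: "\<And>k. real (card (neighbours l d g N k)) \<le> Q"
  shows "(\<Sum>k\<in>{1..N}. \<Sum>j\<in>neighbours l d g N k - {k}. prob (E n k \<inter> E n j))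
    \<le> 2 * K * (\<Sum>k\<in>{1..N}. prob (E n k)) * (Q * p n + C * (\<theta> ^ R / (1 - \<theta>)))"
proof -
  let ?nb = "neighbours l d g N"
  let ?S = "\<Sum>k\<in>{1..N}. \<Sum>j\<in>{j\<in>?nb k. k < j}. prob (E n k \<inter> E n j)"
  have up: "(\<Sum>j\<in>{j\<in>?nb k. k < j}. prob (E n k \<inter> E n j))
     \<le> K * prob (E n k) * (Q * p n + C * (\<theta> ^ R / (1 - \<theta>)))" for k
  proof -
    let ?F = "{j\<in>?nb k. k < j}"
    have finF: "finite ?F" using finite_neighbours by auto
    have "(\<Sum>j\<in>?F. prob (E n k \<inter> E n j))
      \<le> (\<Sum>j\<in>?F. K * prob (E n k) * (p n + (if d l * (j - k) < R then 0 else C * \<theta> ^ (d l * (j - k)))))"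
      by (rule sum_mono, rule pair_bound_decay[OF K _ decay(1-3) R]) auto
    also have "\<dots> = K * prob (E n k) * (card ?F * p n
        + C * (\<Sum>j\<in>?F. if d l * (j - k) < R then 0 else \<theta> ^ (d l * (j - k))))"
    proof -
      have "(\<Sum>j\<in>?F. if d l * (j - k) < R then 0 else C * \<theta> ^ (d l * (j - k)))
        = C * (\<Sum>j\<in>?F. if d l * (j - k) < R then 0 else \<theta> ^ (d l * (j - k)))"
        unfolding sum_distrib_left by (intro sum.cong) auto
      then show ?thesis
        by (simp only: sum_distrib_left[symmetric] sum.distrib sum_constant)
    qed
    also have "\<dots> \<le> K * prob (E n k) * (Q * p n + C * (\<theta> ^ R / (1 - \<theta>)))"
    proof (intro mult_left_mono add_mono mult_right_mono)
      have "real (card ?F) \<le> real (card (?nb k))"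
        by (intro of_nat_mono card_mono finite_neighbours) auto
      then show "real (card ?F) \<le> Q" using Q[of k] by simp
      have "(\<Sum>j\<in>?F. if d l * (j - k) < R then 0 else \<theta> ^ (d l * (j - k)))
          = (\<Sum>j\<in>{j\<in>?F. R \<le> d l * (j - k)}. \<theta> ^ (d l * (j - k)))"
        using finF by (subst sum.inter_filter) (auto intro!: sum.cong simp: not_less)
      also have "\<dots> = (\<Sum>r\<in>(\<lambda>j. d l * (j - k)) ` {j\<in>?F. R \<le> d l * (j - k)}. \<theta> ^ r)"
        using d_l_ge_1 by (subst sum.reindex) (auto simp: inj_on_def eq_diff_iff)
      also have "\<dots> \<le> \<theta> ^ R / (1 - \<theta>)"
        using finite_neighbours[of l d g N k] by (intro sum_geometric_tail_le decay finite_imageI) auto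
      finally show "(\<Sum>j\<in>?F. if d l * (j - k) < R then 0 else \<theta> ^ (d l * (j - k))) \<le> \<theta> ^ R / (1 - \<theta>)" .
    qed (use K(2) decay(2) in auto)
    finally show ?thesis .
  qed
  have "(\<Sum>k\<in>{1..N}. \<Sum>j\<in>?nb k - {k}. prob (E n k \<inter> E n j))
      = ?S + (\<Sum>k\<in>{1..N}. \<Sum>j\<in>{j\<in>?nb k. j < k}. prob (E n k \<inter> E n j))"
  proof -
    have "(\<Sum>j\<in>?nb k - {k}. prob (E n k \<inter> E n j))
       = (\<Sum>j\<in>{j\<in>?nb k. k < j}. prob (E n k \<inter> E n j)) + (\<Sum>j\<in>{j\<in>?nb k. j < k}. prob (E n k \<inter> E n j))" for k
      using finite_neighbours
      by (subst sum.union_disjoint[symmetric]) (auto intro!: sum.cong)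
    then show ?thesis by (simp add: sum.distrib)
  qed
  \<comment> \<open>Being neighbours is symmetric within \<open>{1..N}\<close>, so exchanging the
    indices carries the pairs with \<open>j < k\<close> onto those with
    \<open>k < j\<close>.\<close>
  also have "(\<Sum>k\<in>{1..N}. \<Sum>j\<in>{j\<in>?nb k. j < k}. prob (E n k \<inter> E n j)) = ?S"
  proof -
    define L where "L = (SIGMA k:{1..N}. {j\<in>?nb k. j < k})"
    define U where "U = (SIGMA k:{1..N}. {j\<in>?nb k. k < j})"
    have swap: "(k, j) \<in> L \<longleftrightarrow> (j, k) \<in> U" for k j
    proof -
      have "k \<in> {1..N} \<and> j \<in> ?nb k \<longleftrightarrow> j \<in> {1..N} \<and> k \<in> ?nb j"
        using neighbours_sym neighbours_subset by blast
      then show ?thesis unfolding L_def U_def by blast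
    qed
    have "(\<Sum>k\<in>{1..N}. \<Sum>j\<in>{j\<in>?nb k. j < k}. prob (E n k \<inter> E n j)) = (\<Sum>(k, j)\<in>L. prob (E n k \<inter> E n j))"
      unfolding L_def using finite_neighbours by (intro sum.Sigma) auto
    also have "\<dots> = (\<Sum>(k, j)\<in>U. prob (E n k \<inter> E n j))"
      using swap by (intro sum.reindex_bij_witness[of _ prod.swap prod.swap]) (auto simp: Int_commute)
    also have "\<dots> = ?S"
      unfolding U_def using finite_neighbours by (intro sum.Sigma[symmetric]) auto
    finally show ?thesis .
  qed
  also have "?S + ?S = 2 * ?S" by simp
  also have "\<dots> \<le> 2 * (\<Sum>k\<in>{1..N}. K * prob (E n k) * (Q * p n + C * (\<theta> ^ R / (1 - \<theta>))))"
    using up by (intro mult_left_mono sum_mono) auto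
  also have "\<dots> = 2 * K * (\<Sum>k\<in>{1..N}. prob (E n k)) * (Q * p n + C * (\<theta> ^ R / (1 - \<theta>)))"
    by (simp only: sum_distrib_right[symmetric] sum_distrib_left[symmetric] mult.assoc)
  finally show ?thesis .
qed

section \<open>Mean number of hits and the combined error bound\<close>

abbreviation mean :: "nat \<Rightarrow> nat \<Rightarrow> real" where
  "mean n N \<equiv> \<Sum>k\<in>{1..N}. prob (E n k)"

lemma p_power_le: "p n ^ l \<le> p n"
  using power_decreasing[of 1 l "p n"] l by simp

text \<open>Only from \<open>k = n + m\<close> on is \<open>prob (E n k)\<close> compared with
  \<open>p n ^ l\<close>; the at most \<open>n + m\<close> earlier indices are charged
  \<open>p n\<close> each.\<close>

lemma mean_upper:
  assumes mix: "mixes_up P m c" "mixes_low P m c" "c \<ge> 1"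
  shows "mean n N \<le> real (n + m) * p n + c ^ l * (real N * p n ^ l)"
proof -
  have "mean n N \<le> (\<Sum>k\<in>{1..N}. (if k < n + m then p n else 0) + c ^ l * p n ^ l)"
  proof (rule sum_mono)
    fix k
    have nonneg: "0 \<le> c ^ l * p n ^ l" using mix(3) by simp
    show "prob (E n k) \<le> (if k < n + m then p n else 0) + c ^ l * p n ^ l"
    proof (cases "k < n + m")
      case True
      then show ?thesis
        unfolding if_P[OF True] using nonneg prob_E_le[of n k] by linarith
    next
      case False
      then have "prob (E n k) \<le> c ^ l * p n ^ l"
        by (intro prob_E_bounds(1)[OF mix]) simp
      then show ?thesis
        unfolding if_not_P[OF False] by simp
    qed
  qed
  also have "\<dots> = real (card {k\<in>{1..N}. k < n + m}) * p n + real N * (c ^ l * p n ^ l)"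
    by (simp add: sum.distrib flip: sum.inter_filter)
  also have "\<dots> \<le> real (n + m) * p n + real N * (c ^ l * p n ^ l)"
  proof -
    have "card {k\<in>{1..N}. k < n + m} \<le> card {..<n + m}" by (intro card_mono) auto
    then show ?thesis by (intro add_right_mono mult_right_mono) auto
  qed
  finally show ?thesis by (simp add: mult_ac)
qed

lemma mean_lower:
  assumes mix: "mixes_up P m c" "mixes_low P m c" "c \<ge> 1"
  shows "real N * p n ^ l \<le> real (n + m) * p n + c ^ l * mean n N"
proof -
  have "real N * p n ^ l = (\<Sum>k\<in>{1..N}. p n ^ l)" by simp
  also have "\<dots> \<le> (\<Sum>k\<in>{1..N}. (if k < n + m then p n else 0) + c ^ l * prob (E n k))"
  proof (rule sum_mono)
    fix k
    have nonneg: "0 \<le> c ^ l * prob (E n k)" using mix(3) by simp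
    show "p n ^ l \<le> (if k < n + m then p n else 0) + c ^ l * prob (E n k)"
    proof (cases "k < n + m")
      case True
      then show ?thesis
        unfolding if_P[OF True] using nonneg p_power_le[of n] by linarith
    next
      case False
      then have "p n ^ l \<le> c ^ l * prob (E n k)"
        by (intro prob_E_bounds(2)[OF mix]) simp
      then show ?thesis
        unfolding if_not_P[OF False] by simp
    qed
  qed
  also have "\<dots> = real (card {k\<in>{1..N}. k < n + m}) * p n + c ^ l * mean n N"
    by (simp add: sum.distrib sum_distrib_left flip: sum.inter_filter)
  also have "\<dots> \<le> real (n + m) * p n + c ^ l * mean n N"
  proof -
    have "card {k\<in>{1..N}. k < n + m} \<le> card {..<n + m}" by (intro card_mono) auto
    then show ?thesis by (intro add_right_mono mult_right_mono) auto
  qed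
  finally show ?thesis .
qed

text \<open>Each source of error keeps its own parameter: \<open>c\<close> and \<open>m\<close> for
  decoupling, \<open>K\<close> for pairs without a gap, \<open>R\<close> for the distances at which
  pairs are excluded. All of them can thus be fixed before \<open>n\<close> grows.\<close>

lemma char_hits_approx:
  fixes u :: real
  assumes mix: "mixes_up P m c" "mixes_low P m c" "c \<ge> 1"
    and K: "mixes_up P 0 K" "K \<ge> 1"
    and decay: "\<And>v a n. prob (agree v {a..<a + n}) \<le> C * \<theta> ^ n" "C > 0" "0 < \<theta>" "\<theta> < 1"
    and R: "\<And>r. 1 \<le> r \<Longrightarrow> r < R \<Longrightarrow> A n \<inter> (left_shift ^^ r) -` A n = {}"
    and "n \<ge> 1"
  defines "Q \<equiv> real (l * (l * (2 * (n + m))))"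
  shows "cmod ((CLINT x|P. iexp (u * hits (E n) {1..N} x)) - exp (mean n N * (iexp u - 1)))
    \<le> (4 * K * mean n N * (Q * p n + C * (\<theta> ^ R / (1 - \<theta>))) + 2 * mean n N * (Q * p n)
        + 2 * (real (n + m) * p n) + (c ^ (4 * l) - 1) * mean n N) * exp (2 * mean n N) * \<bar>u\<bar>"
proof -
  let ?nb = "neighbours l d (n + m) N"
  define \<eta> where "\<eta> k = (if k < n + m then 2 * prob (E n k) else (c ^ (4 * l) - 1) * prob (E n k))" for k
  have Q: "real (card (?nb k)) \<le> Q" for k
    unfolding Q_def using card_neighbours[of l d "n + m" N k, OF d_ge_1] by (intro of_nat_mono) auto
  have c1: "1 \<le> c ^ (4 * l)" using mix(3) by (rule one_le_power)
  have mean0: "0 \<le> mean n N" by (intro sum_nonneg) auto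
  have b1: "(\<Sum>k\<in>{1..N}. \<Sum>j\<in>?nb k. prob (E n k) * prob (E n j)) \<le> mean n N * (Q * p n)"
  proof -
    have "(\<Sum>j\<in>?nb k. prob (E n k) * prob (E n j)) \<le> prob (E n k) * (Q * p n)" for k
    proof -
      have "(\<Sum>j\<in>?nb k. prob (E n k) * prob (E n j)) \<le> (\<Sum>j\<in>?nb k. prob (E n k) * p n)"
        using prob_E_le by (intro sum_mono mult_left_mono) auto
      also have "\<dots> = prob (E n k) * (real (card (?nb k)) * p n)" by simp
      also have "\<dots> \<le> prob (E n k) * (Q * p n)"
        using Q by (intro mult_left_mono mult_right_mono) auto
      finally show ?thesis .
    qed
    then show ?thesis unfolding sum_distrib_right by (intro sum_mono) auto
  qed
  have b3: "(\<Sum>k\<in>{1..N}. \<eta> k) \<le> 2 * (real (n + m) * p n) + (c ^ (4 * l) - 1) * mean n N"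
  proof -
    have "(\<Sum>k\<in>{1..N}. \<eta> k) \<le> (\<Sum>k\<in>{1..N}. (if k < n + m then 2 * p n else 0) + (c ^ (4 * l) - 1) * prob (E n k))"
    proof (rule sum_mono)
      fix k
      have "0 \<le> (c ^ (4 * l) - 1) * prob (E n k)"
        using c1 by (intro mult_nonneg_nonneg) auto
      then show "\<eta> k \<le> (if k < n + m then 2 * p n else 0) + (c ^ (4 * l) - 1) * prob (E n k)"
        unfolding \<eta>_def using prob_E_le[of n k] by auto
    qed
    also have "\<dots> = real (card {k\<in>{1..N}. k < n + m}) * (2 * p n) + (c ^ (4 * l) - 1) * mean n N"
      by (simp add: sum.distrib sum_distrib_left flip: sum.inter_filter)
    also have "\<dots> \<le> real (n + m) * (2 * p n) + (c ^ (4 * l) - 1) * mean n N"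
    proof -
      have "card {k\<in>{1..N}. k < n + m} \<le> card {..<n + m}" by (intro card_mono) auto
      then show ?thesis by (intro add_right_mono mult_right_mono) auto
    qed
    finally show ?thesis by simp
  qed
  have b2: "(\<Sum>k\<in>{1..N}. \<Sum>j\<in>?nb k - {k}. prob (E n k \<inter> E n j))
      \<le> 2 * K * mean n N * (Q * p n + C * (\<theta> ^ R / (1 - \<theta>)))"
    by (rule clump_bound[OF K decay R Q])
  have "cmod ((CLINT x|P. iexp (u * hits (E n) {1..N} x)) - exp (mean n N * (iexp u - 1)))
     \<le> (2 * (\<Sum>k\<in>{1..N}. \<Sum>j\<in>?nb k - {k}. prob (E n k \<inter> E n j))
      + 2 * (\<Sum>k\<in>{1..N}. \<Sum>j\<in>?nb k. prob (E n k) * prob (E n j)) + (\<Sum>k\<in>{1..N}. \<eta> k))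
      * exp (2 * mean n N) * \<bar>u\<bar>"
  proof (rule poisson_char_approx)
    show "k \<in> ?nb k" if "k \<in> {1..N}" for k
      using that l \<open>n \<ge> 1\<close> by (intro neighbours_self) auto
    show "?nb k \<subseteq> {1..N}" for k by (rule neighbours_subset)
    show "(\<Sum>w\<le>card ({1..N} - ?nb k). \<bar>prob (E n k \<inter> {x\<in>space P. hits (E n) ({1..N} - ?nb k) x = w})
             - prob (E n k) * prob {x\<in>space P. hits (E n) ({1..N} - ?nb k) x = w}\<bar>) \<le> \<eta> k" for k
      unfolding \<eta>_def using decoupled_count[OF mix, of n k] crude_count[of "{1..N} - ?nb k"]
      by (cases "k < n + m") auto
  qed (auto simp: E_events)
  also have "\<dots> \<le> (4 * K * mean n N * (Q * p n + C * (\<theta> ^ R / (1 - \<theta>))) + 2 * mean n N * (Q * p n)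
        + 2 * (real (n + m) * p n) + (c ^ (4 * l) - 1) * mean n N) * exp (2 * mean n N) * \<bar>u\<bar>"
    using b1 b2 b3 by (intro mult_right_mono) auto
  finally show ?thesis .
qed

end

section \<open>Passage to the limit\<close>

context hit_sums
begin

text \<open>One mismatch between \<open>\<omega>\<close> and its shift by \<open>r\<close> forbids
  this return as soon as the cylinder is long enough to see it. How long depends on
  \<open>r\<close>, so only finitely many \<open>r\<close> are handled at once.\<close>

lemma eventually_no_return:
  assumes "\<not> periodic_seq \<omega>"
  shows "\<forall>\<^sub>F n in sequentially. \<forall>r\<in>{1..<R}. A n \<inter> (left_shift ^^ r) -` A n = {}"
proof (rule eventually_ball_finite)
  show "\<forall>r\<in>{1..<R}. \<forall>\<^sub>F n in sequentially. A n \<inter> (left_shift ^^ r) -` A n = {}"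
  proof
    fix r assume "r \<in> {1..<R}"
    then have "(left_shift ^^ r) \<omega> \<noteq> \<omega>"
      using assms unfolding periodic_seq_def by auto
    then obtain i where i: "\<omega> (i + r) \<noteq> \<omega> i"
      unfolding left_shift_funpow by auto
    have "A n \<inter> (left_shift ^^ r) -` A n = {}" if n: "n > i + r" for n
    proof -
      have False if "x \<in> A n" "(left_shift ^^ r) x \<in> A n" for x
      proof -
        have "\<forall>j<n. x j = \<omega> j" "\<forall>j<n. x (j + r) = \<omega> j"
          using that unfolding cyl_of_eq_agree agree_def left_shift_funpow by auto
        then have "x (i + r) = \<omega> (i + r)" "x (i + r) = \<omega> i"
          using n by (meson, meson le_add1 order.strict_trans1)
        then show False using i by simp
      qed
      then show ?thesis by auto
    qed
    then show "\<forall>\<^sub>F n in sequentially. A n \<inter> (left_shift ^^ r) -` A n = {}"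
      by (rule eventually_mono[OF eventually_gt_at_top])
  qed
qed simp

context
  fixes t :: real and N :: "nat \<Rightarrow> nat"
  assumes t: "t > 0" and psi: "psi_mixing P" and alphabet: "\<exists>a b :: 'a. a \<noteq> b"
    and letters: "\<And>a. prob (cylinder [a]) > 0"
    and pos: "\<And>n. p n > 0" and nonperiodic: "\<not> periodic_seq \<omega>"
  defines "N n \<equiv> nat \<lfloor>t / p n ^ l\<rfloor>"
begin

text \<open>Rounding down costs at most one summand \<open>p n ^ l\<close>, which is at most
  \<open>p n\<close>.\<close>

lemma count_bounds: "real (N n) * p n ^ l \<le> t" "t - p n \<le> real (N n) * p n ^ l"
proof -
  have pl: "p n ^ l > 0" using pos[of n] by simp
  have "0 \<le> t / p n ^ l" using t pl by simp
  then have N: "real (N n) = of_int \<lfloor>t / p n ^ l\<rfloor>" unfolding N_def by simp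
  have "real (N n) \<le> t / p n ^ l" unfolding N by simp
  then show "real (N n) * p n ^ l \<le> t" using pl by (simp add: field_simps)
  have "t / p n ^ l - 1 \<le> real (N n)" unfolding N by linarith
  then have "(t / p n ^ l - 1) * p n ^ l \<le> real (N n) * p n ^ l"
    using pl by (intro mult_right_mono) auto
  then have "t - p n ^ l \<le> real (N n) * p n ^ l" using pos[of n] by (simp add: left_diff_distrib)
  then show "t - p n \<le> real (N n) * p n ^ l" using p_power_le[of n] by linarith
qed

lemma p_tendsto: "p \<longlonglongrightarrow> 0" and n_p_tendsto: "(\<lambda>n. real (n + m) * p n) \<longlonglongrightarrow> 0"
proof -
  obtain C \<theta> where C: "0 < C" and \<theta>: "0 < \<theta>" "\<theta> < 1"
    and decay: "\<And>v a n. prob (agree v {a..<a + n}) \<le> C * \<theta> ^ n"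
    using exponential_decay[OF psi alphabet letters] by metis
  have p_le: "p n \<le> C * \<theta> ^ n" for n
    using decay[of \<omega> 0 n] by (simp add: cyl_of_eq_agree lessThan_atLeast0)
  have pow: "(\<lambda>n. \<theta> ^ n) \<longlonglongrightarrow> 0" using \<theta> by (intro LIMSEQ_power_zero) auto
  have "(\<lambda>n. C * \<theta> ^ n) \<longlonglongrightarrow> C * 0" by (intro tendsto_intros pow)
  then show p: "p \<longlonglongrightarrow> 0"
    using p_le by (intro tendsto_sandwich[of "\<lambda>_. 0" p sequentially "\<lambda>n. C * \<theta> ^ n"]) auto
  have "(\<lambda>n. of_nat n * \<theta> ^ n) \<longlonglongrightarrow> 0" using \<theta> by (intro powser_times_n_limit_0) auto
  then have "(\<lambda>n. C * (of_nat n * \<theta> ^ n)) \<longlonglongrightarrow> C * 0" by (intro tendsto_intros)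
  then have np: "(\<lambda>n. real n * p n) \<longlonglongrightarrow> 0"
  proof (intro tendsto_sandwich[of "\<lambda>_. 0" "\<lambda>n. real n * p n" sequentially "\<lambda>n. C * (of_nat n * \<theta> ^ n)"])
    show "\<forall>\<^sub>F n in sequentially. real n * p n \<le> C * (of_nat n * \<theta> ^ n)"
      using mult_left_mono[OF p_le, of "real n" n for n] by (auto simp: mult_ac)
  qed auto
  have "(\<lambda>n. real n * p n + real m * p n) \<longlonglongrightarrow> 0 + real m * 0"
    by (intro tendsto_intros np p)
  then show "(\<lambda>n. real (n + m) * p n) \<longlonglongrightarrow> 0" by (simp add: distrib_right)
qed

text \<open>First \<open>c > 1\<close> is taken so close to 1 that the factor \<open>c ^ l\<close>
  does not cross the target \<open>a\<close>; this fixes \<open>m\<close>, and the charge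
  \<open>(n + m) * p n\<close> for small indices then vanishes as \<open>n\<close> grows.\<close>

lemma mean_tendsto: "(\<lambda>n. mean n (N n)) \<longlonglongrightarrow> t"
proof (rule order_tendstoI)
  fix a assume a: "a < t"
  have "((\<lambda>c. c ^ l * a) \<longlongrightarrow> 1 ^ l * a) (at_right (1::real))"
    by (intro tendsto_intros)
  then have "\<forall>\<^sub>F c in at_right 1. c ^ l * a < t"
    using a by (intro order_tendstoD) auto
  then have "\<forall>\<^sub>F c in at_right (1::real). c ^ l * a < t \<and> 1 < c"
    using eventually_at_right_less by (rule eventually_conj)
  then obtain c where c: "c ^ l * a < t" "1 < c"
    using eventually_happens by fastforce
  obtain m where mix: "mixes_up P m c" "mixes_low P m c"
    using psi_mixing_close[OF psi c(2)] by blast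
  have "(\<lambda>n. t - p n - real (n + m) * p n) \<longlonglongrightarrow> t - 0 - 0"
    by (intro tendsto_intros p_tendsto n_p_tendsto)
  then have "\<forall>\<^sub>F n in sequentially. c ^ l * a < t - p n - real (n + m) * p n"
    using c by (intro order_tendstoD) auto
  then show "\<forall>\<^sub>F n in sequentially. a < mean n (N n)"
  proof eventually_elim
    case (elim n)
    have "c ^ l * a < c ^ l * mean n (N n)"
      using elim mean_lower[OF mix, of "N n" n] count_bounds(2)[of n] c(2) by linarith
    then show ?case using c(2) by simp
  qed
next
  fix a assume a: "t < a"
  have "((\<lambda>c. c ^ l * t) \<longlongrightarrow> 1 ^ l * t) (at_right (1::real))"
    by (intro tendsto_intros)
  then have "\<forall>\<^sub>F c in at_right 1. c ^ l * t < a"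
    using a by (intro order_tendstoD) auto
  then have "\<forall>\<^sub>F c in at_right (1::real). c ^ l * t < a \<and> 1 < c"
    using eventually_at_right_less by (rule eventually_conj)
  then obtain c where c: "c ^ l * t < a" "1 < c"
    using eventually_happens by fastforce
  obtain m where mix: "mixes_up P m c" "mixes_low P m c"
    using psi_mixing_close[OF psi c(2)] by blast
  have "(\<lambda>n. real (n + m) * p n + c ^ l * t) \<longlonglongrightarrow> 0 + c ^ l * t"
    by (intro tendsto_intros n_p_tendsto)
  then have "\<forall>\<^sub>F n in sequentially. real (n + m) * p n + c ^ l * t < a"
    using c by (intro order_tendstoD) auto
  then show "\<forall>\<^sub>F n in sequentially. mean n (N n) < a"
  proof eventually_elim
    case (elim n)
    have "c ^ l * (real (N n) * p n ^ l) \<le> c ^ l * t"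
      using count_bounds(1) c(2) by (intro mult_left_mono) auto
    then show ?case
      using elim mean_upper[OF mix, of n "N n"] c(2) by linarith
  qed
qed

text \<open>Two parts of the error do not vanish with \<open>n\<close>:
  \<open>(c ^ (4 * l) - 1) * t\<close> from decoupling and the geometric tail from \<open>R\<close>.
  Each is made smaller than \<open>\<epsilon> / 2\<close> beforehand, by \<open>c\<close> close to 1
  and \<open>R\<close> large.\<close>

lemma char_hits_eventually_le:
  fixes u :: real
  assumes "\<epsilon> > 0"
  shows "\<forall>\<^sub>F n in sequentially.
    cmod ((CLINT x|P. iexp (u * hits (E n) {1..N n} x)) - exp (mean n (N n) * (iexp u - 1)))
      \<le> \<epsilon> * exp (2 * (t + 1)) * \<bar>u\<bar>"
proof -
  obtain C \<theta> where C: "0 < C" and \<theta>: "0 < \<theta>" "\<theta> < 1"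
    and decay: "\<And>v a n. prob (agree v {a..<a + n}) \<le> C * \<theta> ^ n"
    using exponential_decay[OF psi alphabet letters] by metis
  obtain K where K: "1 \<le> K" "mixes_up P 0 K"
    using psi_mixing_up[OF psi] by blast
  have "((\<lambda>c. (c ^ (4 * l) - 1) * t) \<longlongrightarrow> (1 ^ (4 * l) - 1) * t) (at_right (1::real))"
    by (intro tendsto_intros)
  then have "\<forall>\<^sub>F c in at_right 1. (c ^ (4 * l) - 1) * t < \<epsilon> / 2"
    using assms by (intro order_tendstoD) auto
  then have "\<forall>\<^sub>F c in at_right (1::real). (c ^ (4 * l) - 1) * t < \<epsilon> / 2 \<and> 1 < c"
    using eventually_at_right_less by (rule eventually_conj)
  then obtain c where c: "(c ^ (4 * l) - 1) * t < \<epsilon> / 2" "1 < c"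
    using eventually_happens by fastforce
  obtain m where mix: "mixes_up P m c" "mixes_low P m c"
    using psi_mixing_close[OF psi c(2)] by blast
  have "(\<lambda>R. 4 * K * t * (C * (\<theta> ^ R / (1 - \<theta>)))) \<longlonglongrightarrow> 4 * K * t * (C * (0 / (1 - \<theta>)))"
    using \<theta> by (intro tendsto_intros LIMSEQ_power_zero) auto
  then have "\<forall>\<^sub>F R in sequentially. 4 * K * t * (C * (\<theta> ^ R / (1 - \<theta>))) < \<epsilon> / 2"
    using assms by (intro order_tendstoD) auto
  then obtain R where R: "4 * K * t * (C * (\<theta> ^ R / (1 - \<theta>))) < \<epsilon> / 2"
    using eventually_happens by fastforce
  define Q where "Q n = real (l * (l * (2 * (n + m))))" for n
  define err where "err n = 4 * K * mean n (N n) * (Q n * p n + C * (\<theta> ^ R / (1 - \<theta>)))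
      + 2 * mean n (N n) * (Q n * p n) + 2 * (real (n + m) * p n) + (c ^ (4 * l) - 1) * mean n (N n)" for n
  have Q: "(\<lambda>n. Q n * p n) \<longlonglongrightarrow> 0"
  proof -
    have "(\<lambda>n. real (l * (l * 2)) * (real (n + m) * p n)) \<longlonglongrightarrow> real (l * (l * 2)) * 0"
      by (intro tendsto_mult tendsto_const n_p_tendsto)
    moreover have "real (l * (l * 2)) * (real (n + m) * p n) = Q n * p n" for n
      unfolding Q_def by (simp add: algebra_simps)
    ultimately show ?thesis by (simp only: mult_zero_right)
  qed
  have "err \<longlonglongrightarrow> 4 * K * t * (0 + C * (\<theta> ^ R / (1 - \<theta>))) + 2 * t * 0 + 2 * 0 + (c ^ (4 * l) - 1) * t"
    unfolding err_def by (intro tendsto_intros mean_tendsto Q n_p_tendsto)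
  then have "\<forall>\<^sub>F n in sequentially. err n < \<epsilon>"
    using c R by (elim order_tendstoD(2)) simp
  moreover have "\<forall>\<^sub>F n in sequentially. mean n (N n) < t + 1"
    using mean_tendsto by (rule order_tendstoD) simp
  ultimately show ?thesis
    using eventually_no_return[OF nonperiodic, of R] eventually_ge_at_top[of 1]
  proof eventually_elim
    case (elim n)
    have no_return: "\<And>r. 1 \<le> r \<Longrightarrow> r < R \<Longrightarrow> A n \<inter> (left_shift ^^ r) -` A n = {}"
      using elim(3) by auto
    have "cmod ((CLINT x|P. iexp (u * hits (E n) {1..N n} x)) - exp (mean n (N n) * (iexp u - 1)))
      \<le> err n * exp (2 * mean n (N n)) * \<bar>u\<bar>"
      unfolding err_def Q_def
      by (rule char_hits_approx[OF mix less_imp_le[OF c(2)] K(2,1) decay C \<theta> no_return elim(4)])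
    also have "\<dots> \<le> \<epsilon> * exp (2 * (t + 1)) * \<bar>u\<bar>"
      using elim(1,2) assms by (intro mult_right_mono mult_mono) auto
    finally show ?case .
  qed
qed

lemma char_hits_tendsto:
  fixes u :: real
  shows "(\<lambda>n. CLINT x|P. iexp (u * hits (E n) {1..N n} x)) \<longlonglongrightarrow> exp (t * (iexp u - 1))"
proof -
  let ?\<phi> = "\<lambda>n. CLINT x|P. iexp (u * hits (E n) {1..N n} x)"
  let ?\<psi> = "\<lambda>n. exp (mean n (N n) * (iexp u - 1)) :: complex"
  have "(\<lambda>n. ?\<phi> n - ?\<psi> n) \<longlonglongrightarrow> 0"
  proof (rule tendstoI)
    fix e :: real assume e: "e > 0"
    define M where "M = exp (2 * (t + 1))"
    have M: "M > 0" unfolding M_def by simp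
    \<comment> \<open>The summand 1 keeps the denominator positive at \<open>u = 0\<close>.\<close>
    define \<epsilon> where "\<epsilon> = e / (M * (\<bar>u\<bar> + 1))"
    have M': "M * (\<bar>u\<bar> + 1) > 0" using M by (intro mult_pos_pos) auto
    have \<epsilon>: "\<epsilon> > 0" unfolding \<epsilon>_def using e M' by simp
    have "\<epsilon> * M * \<bar>u\<bar> < \<epsilon> * (M * (\<bar>u\<bar> + 1))"
      using \<epsilon> M by (simp add: algebra_simps)
    also have "\<dots> = e" unfolding \<epsilon>_def using M M' by simp
    finally have lt: "\<epsilon> * M * \<bar>u\<bar> < e" .
    show "\<forall>\<^sub>F n in sequentially. dist (?\<phi> n - ?\<psi> n) 0 < e"
      using char_hits_eventually_le[OF \<epsilon>, of u] lt unfolding M_def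
      by (auto elim!: eventually_mono simp: dist_norm)
  qed
  moreover have "?\<psi> \<longlonglongrightarrow> exp (complex_of_real t * (iexp u - 1))"
    by (intro tendsto_intros tendsto_of_real mean_tendsto)
  ultimately have "(\<lambda>n. (?\<phi> n - ?\<psi> n) + ?\<psi> n) \<longlonglongrightarrow> 0 + exp (complex_of_real t * (iexp u - 1))"
    by (rule tendsto_add)
  then show ?thesis by simp
qed

end

end

section \<open>Convergence in distribution\<close>

theorem corollary2p4:
  fixes P :: "(nat \<Rightarrow> 'a::countable) measure"
    and l :: nat and d :: "nat \<Rightarrow> nat" and t :: real and \<omega> :: "nat \<Rightarrow> 'a"
  assumes "\<exists>a b :: 'a. a \<noteq> b"
    and "prob_space P"
    and "sets P = sets cylinder_space"
    and "distr P P left_shift = P"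
    and "\<And>a. measure P (cylinder [a]) > 0"
    and "psi_mixing P"
    and "l \<ge> 1"
    and "d 1 \<ge> 1"
    and "strict_mono_on {1..l} d"
    and "t > 0"
    and "\<omega> \<in> Omega_pos P"
    and "\<not> periodic_seq \<omega>"
  shows "weak_conv_m
           (\<lambda>n. distr P borel (S_hit l d (cyl_of \<omega> n) (N_hit P l t \<omega> n)))
           (distr (measure_pmf (poisson_pmf t)) borel real)"
proof -
  interpret prob_space P by fact
  interpret hit_sums P l d \<omega>
    by unfold_locales (use assms in auto)
  \<comment> \<open>\<open>Omega_pos\<close> speaks of \<open>n \<ge> 1\<close> only; for
    \<open>n = 0\<close> the cylinder is the whole space.\<close>
  have pos: "p n > 0" for n
  proof (cases "n = 0")
    case True
    then have "cyl_of \<omega> n = UNIV" unfolding cyl_of_eq_agree agree_def by simp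
    then show ?thesis using prob_space by simp
  next
    case False
    then show ?thesis using assms(11) unfolding Omega_pos_def by simp
  qed
  let ?S = "\<lambda>n. S_hit l d (cyl_of \<omega> n) (N_hit P l t \<omega> n)"
  have S_eq: "?S n = (\<lambda>x. real (hits (E n) {1..nat \<lfloor>t / p n ^ l\<rfloor>} x))" for n
    unfolding N_hit_def by (rule ext) (rule S_hit_eq_hits)
  have S_meas: "?S n \<in> borel_measurable P" for n
    unfolding S_eq using E_events
    by (simp add: hits_eq_sum real_of_nat_indicator)
  show ?thesis
  proof (rule levy_continuity)
    show "real_distribution (distr P borel (?S n))" for n
      by (rule real_distribution_distr[OF S_meas])
    show "real_distribution (distr (measure_pmf (poisson_pmf t)) borel real)"
      by (rule prob_space.real_distribution_distr[OF prob_space_measure_pmf]) simp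
    show "(\<lambda>n. char (distr P borel (?S n)) u)
      \<longlonglongrightarrow> char (distr (measure_pmf (poisson_pmf t)) borel real) u" for u
    proof -
      have "char (distr P borel (?S n)) u = (CLINT x|P. iexp (u * hits (E n) {1..nat \<lfloor>t / p n ^ l\<rfloor>} x))" for n
        unfolding char_def using S_meas by (subst integral_distr) (auto simp: S_eq)
      then show ?thesis
        unfolding char_poisson[OF assms(10)]
        using char_hits_tendsto[OF assms(10,6,1,5) pos assms(12), of u] by simp
    qed
  qed
qed

end
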